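(* Let $(M,g)$ be a compact, oriented Riemannian manifold and $(N,h,J)$ a compact Kähler manifold with Kähler form $\omega=h(J\cdot,\cdot)$. For a smooth variation $\phi_t:M\to N$ of a smooth map $\phi=\phi_0:M\to N$ with variational vector field $X=\frac{\partial\phi_t}{\partial t}\big|_{t=0}\in\Gamma(\phi^{-1}TN)$, we have $$\frac{d}{dt}E(\phi_t)\Big|_{t=0}=\int_M\omega\big(X,d\phi(\sharp\,\delta\phi^*\omega)\big)\,{\ast 1}.$$
   Context: $E(\phi)=\frac12\int_M|\phi^*\omega|^2\,{\ast 1}=\frac12\int_M\phi^*\omega\wedge\ast\phi^*\omega$, where $\ast 1$ is the volume form of $M$ and the pointwise norm on $p$-forms is induced by $\langle\alpha,\beta\rangle=\frac1{p!}\sum_{i_1,\dots,i_p}\alpha(e_{i_1},\dots,e_{i_p})\beta(e_{i_1},\dots,e_{i_p})$ for a local orthonormal frame. $\delta$ is the formal $L^2$-adjoint of the exterior derivative $d$ on forms on $M$. $\sharp:\Gamma(T^*M)\to\Gamma(TM)$ is the inverse of $\flat: X\mapsto g(X,\cdot)$. $\Gamma(\phi^{-1}TN)$ is the space of smooth sections of the pullback bundle $\phi^{-1}TN$ over $M$. *)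

theory Defs
  imports "HOL-Analysis.Analysis"
begin

section \<open>Smooth functions on open subsets of Euclidean spaces\<close>

text \<open>Meant for open \<open>S\<close>: continuously differentiable \<open>k\<close> times, via directional derivatives.\<close>

primrec Ck_on ::
  "nat \<Rightarrow> 'a::euclidean_space set \<Rightarrow> ('a \<Rightarrow> 'b::real_normed_vector) \<Rightarrow> bool" where
  "Ck_on 0 S f \<longleftrightarrow> continuous_on S f"
| "Ck_on (Suc k) S f \<longleftrightarrow>
     (\<forall>x\<in>S. f differentiable (at x)) \<and>
     (\<forall>v. Ck_on k S (\<lambda>x. frechet_derivative f (at x) v))"

definition smooth_on :: "'a::euclidean_space set \<Rightarrow> ('a \<Rightarrow> 'b::real_normed_vector) \<Rightarrow> bool" where
  "smooth_on S f \<longleftrightarrow> (\<forall>k. Ck_on k S f)"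


section \<open>Smooth manifolds and smooth maps\<close>

text \<open>
  The underlying set of a manifold is a type \<open>'m\<close> with its class topology. A chart is a pair of an
  open domain and a coordinate map; values of the map outside the domain are irrelevant.
\<close>

type_synonym ('m, 'e) chart = "'m set \<times> ('m \<Rightarrow> 'e)"

abbreviation chart_dom :: "('m, 'e) chart \<Rightarrow> 'm set" where
  "chart_dom c \<equiv> fst c"

abbreviation chart_map :: "('m, 'e) chart \<Rightarrow> 'm \<Rightarrow> 'e" where
  "chart_map c \<equiv> snd c"

abbreviation chart_inv :: "('m, 'e) chart \<Rightarrow> 'e \<Rightarrow> 'm" where
  "chart_inv c \<equiv> inv_into (chart_dom c) (chart_map c)"

abbreviation chart_image :: "('m, 'e) chart \<Rightarrow> 'e set" where
  "chart_image c \<equiv> chart_map c ` chart_dom c"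

definition is_chart :: "('m::topological_space, 'e::euclidean_space) chart \<Rightarrow> bool" where
  "is_chart c \<longleftrightarrow> open (chart_dom c) \<and> open (chart_image c) \<and>
     homeomorphism (chart_dom c) (chart_image c) (chart_map c) (chart_inv c)"

definition transition :: "('m, 'e) chart \<Rightarrow> ('m, 'e) chart \<Rightarrow> 'e \<Rightarrow> 'e" where
  "transition c d = chart_map d \<circ> chart_inv c"

definition compatible ::
  "('m::topological_space, 'e::euclidean_space) chart \<Rightarrow> ('m, 'e) chart \<Rightarrow> bool" where
  "compatible c d \<longleftrightarrow>
     smooth_on (chart_map c ` (chart_dom c \<inter> chart_dom d)) (transition c d) \<and>
     smooth_on (chart_map d ` (chart_dom c \<inter> chart_dom d)) (transition d c)"

text \<open>
  The sort supplies the Hausdorff and second countability axioms. The atlas need not be maximal;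
  \<open>smooth_chart\<close> describes the members of the maximal atlas it generates.
\<close>

definition smooth_atlas ::
  "('m::{t2_space,second_countable_topology}, 'e::euclidean_space) chart set \<Rightarrow> bool" where
  "smooth_atlas A \<longleftrightarrow> (\<forall>c\<in>A. is_chart c) \<and> (\<Union>c\<in>A. chart_dom c) = UNIV \<and>
     (\<forall>c\<in>A. \<forall>d\<in>A. compatible c d)"

definition smooth_chart ::
  "('m::topological_space, 'e::euclidean_space) chart set \<Rightarrow> ('m, 'e) chart \<Rightarrow> bool" where
  "smooth_chart A c \<longleftrightarrow> is_chart c \<and> (\<forall>d\<in>A. compatible c d)"

definition oriented_atlas ::
  "('m::{t2_space,second_countable_topology}, real^'k) chart set \<Rightarrow> bool" where
  "oriented_atlas A \<longleftrightarrow> smooth_atlas A \<and>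
     (\<forall>c\<in>A. \<forall>d\<in>A. \<forall>p \<in> chart_dom c \<inter> chart_dom d.
        det (matrix (frechet_derivative (transition c d) (at (chart_map c p)))) > 0)"

definition smooth_map_on ::
  "('m::topological_space, 'e::euclidean_space) chart set \<Rightarrow>
   ('n::topological_space, 'f::euclidean_space) chart set \<Rightarrow> 'm set \<Rightarrow> ('m \<Rightarrow> 'n) \<Rightarrow> bool" where
  "smooth_map_on A B W f \<longleftrightarrow> open W \<and> continuous_on W f \<and>
     (\<forall>c\<in>A. \<forall>d\<in>B.
        smooth_on (chart_map c ` {p \<in> W \<inter> chart_dom c. f p \<in> chart_dom d})
                  (chart_map d \<circ> f \<circ> chart_inv c))"

text \<open>The product atlas of \<open>\<real> \<times> M\<close>.\<close>

definition line_times :: "('m, 'e) chart set \<Rightarrow> (real \<times> 'm, real \<times> 'e) chart set" where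
  "line_times A = (\<lambda>c. (UNIV \<times> chart_dom c, map_prod id (chart_map c))) ` A"

definition smooth_variation ::
  "('m::topological_space, 'e::euclidean_space) chart set \<Rightarrow>
   ('n::topological_space, 'f::euclidean_space) chart set \<Rightarrow>
   ('m \<Rightarrow> 'n) \<Rightarrow> (real \<Rightarrow> 'm \<Rightarrow> 'n) \<Rightarrow> bool" where
  "smooth_variation A B \<phi> \<Phi> \<longleftrightarrow> \<Phi> 0 = \<phi> \<and>
     (\<exists>\<epsilon>>0. smooth_map_on (line_times A) B ({-\<epsilon><..<\<epsilon>} \<times> UNIV) (\<lambda>(t, p). \<Phi> t p))"


section \<open>Tangent vectors\<close>

text \<open>
  For every point \<open>p\<close> a chart of the atlas around \<open>p\<close> is chosen, and \<open>T\<^sub>pM\<close> is identified with the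
  model space \<open>'e\<close> by means of that chart. So a vector field along a map is a function into the
  model space, to be read at each point through the chosen chart there; such a function need not
  be continuous when the field is smooth.
\<close>

definition chart_at :: "('m, 'e) chart set \<Rightarrow> 'm \<Rightarrow> ('m, 'e) chart" where
  "chart_at A p = (SOME c. c \<in> A \<and> p \<in> chart_dom c)"

text \<open>Components of \<open>v \<in> T\<^sub>pM\<close> in the chart \<open>c\<close>, and the inverse operation.\<close>

definition to_coords ::
  "('m, 'e::euclidean_space) chart set \<Rightarrow> ('m, 'e) chart \<Rightarrow> 'm \<Rightarrow> 'e \<Rightarrow> 'e" where
  "to_coords A c p =
     frechet_derivative (transition (chart_at A p) c) (at (chart_map (chart_at A p) p))"

definition from_coords ::
  "('m, 'e::euclidean_space) chart set \<Rightarrow> ('m, 'e) chart \<Rightarrow> 'm \<Rightarrow> 'e \<Rightarrow> 'e" where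
  "from_coords A c p =
     frechet_derivative (transition c (chart_at A p)) (at (chart_map c p))"

text \<open>The differential \<open>df\<^sub>p : T\<^sub>pM \<rightarrow> T\<^bsub>f p\<^esub>N\<close>.\<close>

definition tangent_map ::
  "('m, 'e::euclidean_space) chart set \<Rightarrow> ('n, 'f::euclidean_space) chart set \<Rightarrow>
   ('m \<Rightarrow> 'n) \<Rightarrow> 'm \<Rightarrow> 'e \<Rightarrow> 'f" where
  "tangent_map A B f p =
     frechet_derivative (chart_map (chart_at B (f p)) \<circ> f \<circ> chart_inv (chart_at A p))
       (at (chart_map (chart_at A p) p))"

definition velocity ::
  "('n, 'f::euclidean_space) chart set \<Rightarrow> (real \<Rightarrow> 'n) \<Rightarrow> real \<Rightarrow> 'f" where
  "velocity B \<gamma> t = vector_derivative (chart_map (chart_at B (\<gamma> t)) \<circ> \<gamma>) (at t)"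


section \<open>Covariant tensors and differential forms\<close>

text \<open>
  A covariant \<open>k\<close>-tensor field \<open>\<alpha>\<close> is evaluated at \<open>p\<close> on a list of \<open>k\<close> tangent vectors; its values
  on lists of other lengths are irrelevant.
\<close>

type_synonym ('m, 'e) tensor = "'m \<Rightarrow> 'e list \<Rightarrow> real"

definition tensor_coords ::
  "('m, 'e::euclidean_space) chart set \<Rightarrow> ('m, 'e) chart \<Rightarrow> ('m, 'e) tensor \<Rightarrow>
   'e \<Rightarrow> 'e list \<Rightarrow> real" where
  "tensor_coords A c \<alpha> x vs = \<alpha> (chart_inv c x) (map (from_coords A c (chart_inv c x)) vs)"

definition smooth_tensor ::
  "('m, 'e::euclidean_space) chart set \<Rightarrow> nat \<Rightarrow> ('m, 'e) tensor \<Rightarrow> bool" where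
  "smooth_tensor A k \<alpha> \<longleftrightarrow>
     (\<forall>p vs i. length vs = k \<and> i < k \<longrightarrow> linear (\<lambda>u. \<alpha> p (vs[i := u]))) \<and>
     (\<forall>c\<in>A. \<forall>vs. length vs = k \<longrightarrow>
        smooth_on (chart_image c) (\<lambda>x. tensor_coords A c \<alpha> x vs))"

definition smooth_form ::
  "('m, 'e::euclidean_space) chart set \<Rightarrow> nat \<Rightarrow> ('m, 'e) tensor \<Rightarrow> bool" where
  "smooth_form A k \<alpha> \<longleftrightarrow> smooth_tensor A k \<alpha> \<and>
     (\<forall>p vs i j. length vs = k \<and> i < j \<and> j < k \<and> vs ! i = vs ! j \<longrightarrow> \<alpha> p vs = 0)"

definition pullback ::
  "('m, 'e::euclidean_space) chart set \<Rightarrow> ('n, 'f::euclidean_space) chart set \<Rightarrow>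
   ('m \<Rightarrow> 'n) \<Rightarrow> ('n, 'f) tensor \<Rightarrow> ('m, 'e) tensor" where
  "pullback A B f \<alpha> p vs = \<alpha> (f p) (map (tangent_map A B f p) vs)"

text \<open>
  \<open>d\<alpha>(v\<^sub>0,\<dots>,v\<^sub>k) = \<Sum>\<^sub>i (-1)\<^sup>i \<partial>\<^bsub>v\<^sub>i\<^esub> \<alpha>(v\<^sub>0,\<dots>,v\<^sub>i omitted,\<dots>,v\<^sub>k)\<close>, the \<open>v\<^sub>i\<close> being extended with
  constant components in the chosen chart at the point.
\<close>

definition ext_deriv ::
  "('m, 'e::euclidean_space) chart set \<Rightarrow> ('m, 'e) tensor \<Rightarrow> ('m, 'e) tensor" where
  "ext_deriv A \<alpha> p vs =
     (\<Sum>i<length vs. (-1) ^ i *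
        frechet_derivative
          (\<lambda>x. tensor_coords A (chart_at A p) \<alpha> x (take i vs @ drop (Suc i) vs))
          (at (chart_map (chart_at A p) p)) (vs ! i))"


section \<open>Riemannian metrics\<close>

definition riemannian_metric ::
  "('m, 'e::euclidean_space) chart set \<Rightarrow> ('m, 'e) tensor \<Rightarrow> bool" where
  "riemannian_metric A g \<longleftrightarrow> smooth_tensor A 2 g \<and>
     (\<forall>p u v. g p [u, v] = g p [v, u]) \<and> (\<forall>p u. u \<noteq> 0 \<longrightarrow> g p [u, u] > 0)"

definition orthonormal_basis ::
  "('m, 'e::euclidean_space) tensor \<Rightarrow> 'm \<Rightarrow> 'e set \<Rightarrow> bool" where
  "orthonormal_basis g p b \<longleftrightarrow> finite b \<and> card b = DIM('e) \<and>
     (\<forall>u\<in>b. \<forall>v\<in>b. g p [u, v] = (if u = v then 1 else 0))"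

text \<open>The pointwise inner product of \<open>k\<close>-forms; it does not depend on the orthonormal basis.\<close>

definition form_inner ::
  "('m, 'e::euclidean_space) tensor \<Rightarrow> nat \<Rightarrow> ('m, 'e) tensor \<Rightarrow> ('m, 'e) tensor \<Rightarrow>
   'm \<Rightarrow> real" where
  "form_inner g k \<alpha> \<beta> p =
     (let b = (SOME b. orthonormal_basis g p b)
      in (\<Sum>es | length es = k \<and> set es \<subseteq> b. \<alpha> p es * \<beta> p es) / fact k)"

definition sharp :: "('m, 'e::euclidean_space) tensor \<Rightarrow> ('m, 'e) tensor \<Rightarrow> 'm \<Rightarrow> 'e" where
  "sharp g \<eta> p = (THE u. \<forall>v. g p [u, v] = \<eta> p [v])"


section \<open>Integration over a compact oriented manifold\<close>

text \<open>
  A form of top degree on a manifold modelled on \<open>real^'k\<close> is evaluated on frames whose vectors are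
  indexed by \<open>'k\<close> itself, given as the rows of a matrix. This avoids ordering the index type.
\<close>

type_synonym ('m, 'k) top_form = "'m \<Rightarrow> real^'k^'k \<Rightarrow> real"

text \<open>
  \<open>\<surd>det(g\<^sub>i\<^sub>j) dx\<^sup>1 \<and> \<dots> \<and> dx\<^sup>n\<close> in the chosen chart at \<open>p\<close>, which is positively oriented when the atlas
  is oriented.
\<close>

definition volume_form :: "('m, real^'k) tensor \<Rightarrow> ('m, 'k::finite) top_form" where
  "volume_form g p V = sqrt (det (\<chi> i j. g p [axis i 1, axis j 1])) * det V"

text \<open>
  Continuity of the partition functions suffices for integration: the value of the integral of a
  continuous form is the same for all partitions below, including the smooth ones.
\<close>

definition partition_of_unity ::
  "('m::topological_space, 'e) chart set \<Rightarrow> ('m, 'e) chart set \<Rightarrow>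
   (('m, 'e) chart \<Rightarrow> 'm \<Rightarrow> real) \<Rightarrow> bool" where
  "partition_of_unity A C \<rho> \<longleftrightarrow> finite C \<and> C \<subseteq> A \<and>
     (\<forall>c\<in>C. continuous_on UNIV (\<rho> c) \<and> (\<forall>p. \<rho> c p \<ge> 0) \<and>
            closure {p. \<rho> c p \<noteq> 0} \<subseteq> chart_dom c) \<and>
     (\<forall>p. (\<Sum>c\<in>C. \<rho> c p) = 1)"

definition form_integral ::
  "('m::topological_space, real^'k) chart set \<Rightarrow> ('m, 'k::finite) top_form \<Rightarrow> real" where
  "form_integral A \<eta> =
     (let (C, \<rho>) = (SOME (C, \<rho>). partition_of_unity A C \<rho>)
      in \<Sum>c\<in>C. integral (chart_image c)
           (\<lambda>x. let p = chart_inv c x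
                 in \<rho> c p * \<eta> p (\<chi> i. from_coords A c p (axis i 1))))"

text \<open>\<open>\<integral>\<^sub>M f \<star>1\<close>\<close>

definition integral_vol ::
  "('m::topological_space, real^'k) chart set \<Rightarrow> ('m, real^'k) tensor \<Rightarrow>
   ('m \<Rightarrow> real) \<Rightarrow> real" where
  "integral_vol A g f = form_integral A (\<lambda>p V. f p * volume_form g p V)"

text \<open>\<open>\<delta>\<close> is the formal \<open>L\<^sup>2\<close>-adjoint of \<open>d\<close>, taking \<open>(k+1)\<close>-forms to \<open>k\<close>-forms.\<close>

definition codifferential ::
  "('m::topological_space, real^'k) chart set \<Rightarrow> ('m, real^'k) tensor \<Rightarrow> nat \<Rightarrow>
   (('m, real^'k) tensor \<Rightarrow> ('m, real^'k) tensor) \<Rightarrow> bool" where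
  "codifferential A g k \<delta> \<longleftrightarrow>
     (\<forall>\<beta>. smooth_form A (Suc k) \<beta> \<longrightarrow> smooth_form A k (\<delta> \<beta>) \<and>
        (\<forall>\<alpha>. smooth_form A k \<alpha> \<longrightarrow>
           integral_vol A g (form_inner g (Suc k) (ext_deriv A \<alpha>) \<beta>) =
           integral_vol A g (form_inner g k \<alpha> (\<delta> \<beta>))))"


section \<open>Kaehler manifolds\<close>

text \<open>
  \<open>J\<close> comes from a complex manifold: there are smooth charts around every point in which \<open>J\<close> is a
  constant complex structure \<open>K\<close> of the model space. The transition maps between such charts are
  holomorphic, and \<open>J\<close> is automatically smooth.
\<close>

definition complex_structure ::
  "('n::topological_space, 'f::euclidean_space) chart set \<Rightarrow> ('n \<Rightarrow> 'f \<Rightarrow> 'f) \<Rightarrow> bool" where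
  "complex_structure B J \<longleftrightarrow>
     (\<forall>q. linear (J q) \<and> (\<forall>v. J q (J q v) = - v)) \<and>
     (\<forall>q0. \<exists>c K. smooth_chart B c \<and> q0 \<in> chart_dom c \<and>
        (\<forall>q\<in>chart_dom c. \<forall>v. to_coords B c q (J q v) = K (to_coords B c q v)))"

definition kaehler_form ::
  "('n, 'f::euclidean_space) tensor \<Rightarrow> ('n \<Rightarrow> 'f \<Rightarrow> 'f) \<Rightarrow> ('n, 'f) tensor" where
  "kaehler_form h J q vs = h q [J q (vs ! 0), vs ! 1]"

definition kaehler_manifold ::
  "('n::{t2_space,second_countable_topology}, 'f::euclidean_space) chart set \<Rightarrow>
   ('n, 'f) tensor \<Rightarrow> ('n \<Rightarrow> 'f \<Rightarrow> 'f) \<Rightarrow> bool" where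
  "kaehler_manifold B h J \<longleftrightarrow> smooth_atlas B \<and> riemannian_metric B h \<and> complex_structure B J \<and>
     (\<forall>q u v. h q [J q u, J q v] = h q [u, v]) \<and>
     (\<forall>q u v w. ext_deriv B (kaehler_form h J) q [u, v, w] = 0)"

text \<open>\<open>E(\<phi>) = \<onehalf> \<integral>\<^sub>M |\<phi>\<^sup>*\<omega>|\<^sup>2 \<star>1\<close>\<close>

definition energy ::
  "('m::topological_space, real^'k) chart set \<Rightarrow> ('m, real^'k) tensor \<Rightarrow>
   ('n, 'f::euclidean_space) chart set \<Rightarrow> ('n, 'f) tensor \<Rightarrow> ('m \<Rightarrow> 'n) \<Rightarrow> real" where
  "energy A g B \<omega> \<phi> =
     1/2 * integral_vol A g (form_inner g 2 (pullback A B \<phi> \<omega>) (pullback A B \<phi> \<omega>))"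

end

theory Submission
  imports Defs
begin

text \<open>
  Put \<open>\<iota>(v) = \<omega>(X, d\<phi> v)\<close>, a smooth 1-form on \<open>M\<close>. Since \<open>\<omega>\<close> is closed, Cartan's formula gives
  \<open>d/dt \<phi>\<^sub>t\<^sup>*\<omega> = d\<iota>\<close> at \<open>t = 0\<close>, so differentiating under the integral sign yields
  \<open>\<integral> \<langle>d\<iota>, \<phi>\<^sup>*\<omega>\<rangle> = \<integral> \<langle>\<iota>, \<delta>\<phi>\<^sup>*\<omega>\<rangle> = \<integral> \<iota>(\<sharp>\<delta>\<phi>\<^sup>*\<omega>)\<close>. All integrals are taken with the same
  partition of unity, so neither its choice nor Stokes' theorem plays a role. The orthonormal bases
  of the pointwise norm are chosen without any continuity; to see that the integrand is continuous,
  the norm is rewritten with the inverse Gram matrix of a coordinate frame.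
\<close>

section \<open>Calculus of smooth functions\<close>

text \<open>\<open>X\<close> is a section along \<phi> and not a vector field on \<open>N\<close>,
  so Cartan's formula is read on the product of the time line with \<open>M\<close>. In charts, the
  derivative of (t, x) \<mapsto> \<phi>_t(x) in direction \<open>(1, 0)\<close> represents
  \<open>X\<close> and in direction \<open>(0, u)\<close> the differential of \<phi>_t; the pullback
  and \<iota> are then one and the same expression with different directions filled in. The encoding
  of tangent spaces shapes the rest. A vector at p is read in the chart \<open>chart_at A p\<close>,
  which may jump from point to point, so continuity and differentiation make sense only for
  components in a fixed chart, obtained with \<open>from_coords\<close>; each geometric object
  therefore gets a lemma describing its components. Since \<delta> is known only through the adjoint
  relation between smooth forms, both \<iota> and the pullback of \<omega> have to be proved smooth.
  For \<omega> this rests on the smoothness of \<open>J\<close>, which is deduced from the charts in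
  which \<open>J\<close> is constant.\<close>

lemma frechet_derivative_cong_open:
  assumes "open S" "x \<in> S" "\<And>y. y \<in> S \<Longrightarrow> f y = g y"
  shows "frechet_derivative f (at x) = frechet_derivative g (at x)"
proof -
  have "(f has_derivative F) (at x) \<longleftrightarrow> (g has_derivative F) (at x)" for F
    using assms has_derivative_transform_within_open[of f F x UNIV S g]
      has_derivative_transform_within_open[of g F x UNIV S f] by auto
  then show ?thesis unfolding frechet_derivative_def by simp
qed

lemma differentiable_cong_open:
  assumes "open S" "x \<in> S" "\<And>y. y \<in> S \<Longrightarrow> f y = g y" "f differentiable (at x)"
  shows "g differentiable (at x)"
  using assms has_derivative_transform_within_open[of f _ x UNIV S g]
  unfolding differentiable_def by metis

lemma frechet_derivative_worksI:
  "f differentiable (at x) \<Longrightarrow> (f has_derivative frechet_derivative f (at x)) (at x)"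
  using frechet_derivative_works by blast

lemma frechet_derivative_eq:
  "(f has_derivative F) (at x) \<Longrightarrow> frechet_derivative f (at x) v = F v"
  using frechet_derivative_at by metis

text \<open>A derivative at a point of \<open>S\<close> sees a full neighbourhood, so agreement on
  \<open>S\<close> carries over to derivatives because \<open>S\<close> is open.\<close>

lemma Ck_on_cong:
  assumes "open S" "\<And>y. y \<in> S \<Longrightarrow> f y = g y" "Ck_on k S f"
  shows "Ck_on k S g"
  using assms(2,3)
proof (induction k arbitrary: f g)
  case 0
  then show ?case using continuous_on_cong[of S S f g] by simp
next
  case (Suc k)
  have "g differentiable (at x)" if "x \<in> S" for x
    using differentiable_cong_open[OF assms(1) that, of f g] Suc.prems that by auto
  moreover have "Ck_on k S (\<lambda>x. frechet_derivative g (at x) v)" for v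
  proof (rule Suc.IH[of "\<lambda>x. frechet_derivative f (at x) v"])
    show "frechet_derivative f (at y) v = frechet_derivative g (at y) v" if "y \<in> S" for y
      using frechet_derivative_cong_open[OF assms(1) that, of f g] Suc.prems(1) by simp
  qed (use Suc.prems in auto)
  ultimately show ?case by simp
qed

lemma Ck_on_SucD: "Ck_on (Suc k) S f \<Longrightarrow> Ck_on k S f"
proof (induction k arbitrary: f)
  case 0
  then show ?case
    by (auto intro!: continuous_at_imp_continuous_on differentiable_imp_continuous_within)
next
  case (Suc k)
  then show ?case using Ck_on.simps(2) by blast
qed

lemma Ck_on_subset: "Ck_on k S f \<Longrightarrow> T \<subseteq> S \<Longrightarrow> Ck_on k T f"
proof (induction k arbitrary: f)
  case 0
  then show ?case using continuous_on_subset by auto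
next
  case (Suc k)
  then show ?case by auto
qed

lemma Ck_on_local:
  assumes "\<And>x. x \<in> S \<Longrightarrow> \<exists>U. open U \<and> x \<in> U \<and> Ck_on k U f"
  shows "Ck_on k S f"
  using assms
proof (induction k arbitrary: f)
  case 0
  then show ?case
    by (auto intro!: continuous_at_imp_continuous_on) (metis continuous_on_eq_continuous_at)
next
  case (Suc k)
  have "f differentiable (at x)" if "x \<in> S" for x using Suc.prems[OF that] by auto
  moreover have "Ck_on k S (\<lambda>x. frechet_derivative f (at x) v)" for v
    by (rule Suc.IH) (use Suc.prems in fastforce)
  ultimately show ?case by simp
qed

lemma Ck_on_const: "Ck_on k S (\<lambda>x. c)"
  by (induction k arbitrary: c) (auto simp: frechet_derivative_const)

text \<open>Pattern of the closure lemmas below: the formula \<open>d\<close> builds the directional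
  derivative by the same operations from directional derivatives of the ingredients, so the
  induction leaves the functions arbitrary.\<close>

lemma Ck_on_bounded_linear:
  assumes "bounded_linear L" "open S" "Ck_on k S f"
  shows "Ck_on k S (\<lambda>x. L (f x))"
  using assms(3)
proof (induction k arbitrary: f)
  case 0
  then show ?case using bounded_linear.continuous_on[OF assms(1)] by auto
next
  case (Suc k)
  have d: "((\<lambda>x. L (f x)) has_derivative (\<lambda>v. L (frechet_derivative f (at x) v))) (at x)" if "x \<in> S" for x
    using Suc.prems that by (intro bounded_linear.has_derivative[OF assms(1)] frechet_derivative_worksI) auto
  have "Ck_on k S (\<lambda>x. frechet_derivative (\<lambda>x. L (f x)) (at x) v)" for v
    by (rule Ck_on_cong[OF assms(2) _ Suc.IH[of "\<lambda>x. frechet_derivative f (at x) v"]])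
       (use Suc.prems in \<open>auto simp: frechet_derivative_eq[OF d]\<close>)
  moreover have "(\<lambda>x. L (f x)) differentiable (at x)" if "x \<in> S" for x
    using d[OF that] differentiable_def by blast
  ultimately show ?case by simp
qed

lemma Ck_on_id: "Ck_on k S (\<lambda>x. x)"
  by (cases k) (auto simp: Ck_on_const)

lemma Ck_on_add:
  assumes "open S" "Ck_on k S f" "Ck_on k S g"
  shows "Ck_on k S (\<lambda>x. f x + g x)"
  using assms(2,3)
proof (induction k arbitrary: f g)
  case 0
  then show ?case by (auto intro: continuous_on_add)
next
  case (Suc k)
  have d: "((\<lambda>x. f x + g x) has_derivative
      (\<lambda>v. frechet_derivative f (at x) v + frechet_derivative g (at x) v)) (at x)" if "x \<in> S" for x
    using Suc.prems that by (intro has_derivative_add frechet_derivative_worksI) auto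
  have "Ck_on k S (\<lambda>x. frechet_derivative (\<lambda>x. f x + g x) (at x) v)" for v
    by (rule Ck_on_cong[OF assms(1) _ Suc.IH[of "\<lambda>x. frechet_derivative f (at x) v"
            "\<lambda>x. frechet_derivative g (at x) v"]])
       (use Suc.prems in \<open>auto simp: frechet_derivative_eq[OF d]\<close>)
  moreover have "(\<lambda>x. f x + g x) differentiable (at x)" if "x \<in> S" for x
    using d[OF that] differentiable_def by blast
  ultimately show ?case by simp
qed

lemma Ck_on_bounded_bilinear:
  assumes "bounded_bilinear P" "open S" "Ck_on k S f" "Ck_on k S g"
  shows "Ck_on k S (\<lambda>x. P (f x) (g x))"
  using assms(3,4)
proof (induction k arbitrary: f g)
  case 0
  then show ?case using bounded_bilinear.continuous_on[OF assms(1)] by auto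
next
  case (Suc k)
  have d: "((\<lambda>x. P (f x) (g x)) has_derivative
      (\<lambda>v. P (f x) (frechet_derivative g (at x) v) + P (frechet_derivative f (at x) v) (g x))) (at x)"
    if "x \<in> S" for x
    using Suc.prems that
    by (intro bounded_bilinear.FDERIV[OF assms(1)] frechet_derivative_worksI) auto
  \<comment> \<open>The product rule pairs a differentiated factor with an undifferentiated one; the
    latter is brought down to order \<open>k\<close> by \<open>Ck_on_SucD\<close>.\<close>
  have "Ck_on k S (\<lambda>x. frechet_derivative (\<lambda>x. P (f x) (g x)) (at x) v)" for v
    by (rule Ck_on_cong[OF assms(2) _ Ck_on_add[OF assms(2)
            Suc.IH[of f "\<lambda>x. frechet_derivative g (at x) v"]
            Suc.IH[of "\<lambda>x. frechet_derivative f (at x) v" g]]])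
       (use Suc.prems Suc.prems[THEN Ck_on_SucD] in \<open>auto simp: frechet_derivative_eq[OF d]\<close>)
  moreover have "(\<lambda>x. P (f x) (g x)) differentiable (at x)" if "x \<in> S" for x
    using d[OF that] differentiable_def by blast
  ultimately show ?case by simp
qed

lemma Ck_on_sum:
  assumes "open S" "\<And>i. i \<in> I \<Longrightarrow> Ck_on k S (f i)"
  shows "Ck_on k S (\<lambda>x. \<Sum>i\<in>I. f i x)"
  using assms(2) by (induction I rule: infinite_finite_induct) (auto simp: Ck_on_const Ck_on_add[OF assms(1)])

text \<open>\<open>Ck_on\<close> controls derivatives in fixed directions only; the expansion
  reduces a linear map applied to a moving vector to fixed directions with scalar
  coefficients.\<close>

lemma linear_euclidean_expand:
  fixes L :: "'a::euclidean_space \<Rightarrow> 'b::real_vector"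
  assumes "linear L"
  shows "L v = (\<Sum>b\<in>Basis. (v \<bullet> b) *\<^sub>R L b)"
proof -
  have "L v = L (\<Sum>b\<in>Basis. (v \<bullet> b) *\<^sub>R b)" by (simp add: euclidean_representation)
  then show ?thesis by (simp add: linear_sum[OF assms] linear_scale[OF assms])
qed

lemma Ck_on_compose:
  fixes f :: "'a::euclidean_space \<Rightarrow> 'b::euclidean_space" and g :: "'b \<Rightarrow> 'c::real_normed_vector"
  assumes "open S" "open T" "f ` S \<subseteq> T" "Ck_on k T g" "Ck_on k S f"
  shows "Ck_on k S (\<lambda>x. g (f x))"
  using assms(4,5)
proof (induction k arbitrary: g)
  case 0
  then show ?case using assms(3) continuous_on_compose2 by auto
next
  case (Suc k)
  \<comment> \<open>By the chain rule \<open>g\<close> is differentiated in a direction that moves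
    with \<open>x\<close>; after the expansion over \<open>Basis\<close> the directions are fixed,
    and the induction hypothesis applies to the directional derivatives of \<open>g\<close>.\<close>
  have d: "((\<lambda>x. g (f x)) has_derivative
      (\<lambda>v. \<Sum>b\<in>Basis. (frechet_derivative f (at x) v \<bullet> b) *\<^sub>R frechet_derivative g (at (f x)) b)) (at x)"
    if "x \<in> S" for x
  proof -
    have "f differentiable (at x)" "g differentiable (at (f x))" using Suc.prems that assms(3) by auto
    then have "(g \<circ> f has_derivative (frechet_derivative g (at (f x)) \<circ> frechet_derivative f (at x))) (at x)"
      by (intro diff_chain_at frechet_derivative_worksI)
    moreover have "frechet_derivative g (at (f x)) \<circ> frechet_derivative f (at x) = (\<lambda>v. \<Sum>b\<in>Basis.
        (frechet_derivative f (at x) v \<bullet> b) *\<^sub>R frechet_derivative g (at (f x)) b)"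
      unfolding o_def
      by (rule ext, rule linear_euclidean_expand[OF linear_frechet_derivative[OF \<open>g differentiable (at (f x))\<close>]])
    ultimately show ?thesis by (simp add: o_def)
  qed
  have "Ck_on k S (\<lambda>x. \<Sum>b\<in>Basis. (frechet_derivative f (at x) v \<bullet> b) *\<^sub>R frechet_derivative g (at (f x)) b)" for v
    using Suc.prems Suc.prems[THEN Ck_on_SucD]
    by (intro Ck_on_sum[OF assms(1)] Ck_on_bounded_bilinear[OF bounded_bilinear_scaleR assms(1)]
        Ck_on_bounded_linear[OF bounded_linear_inner_left assms(1)] Suc.IH) auto
  then have "Ck_on k S (\<lambda>x. frechet_derivative (\<lambda>x. g (f x)) (at x) v)" for v
    by (rule Ck_on_cong[OF assms(1), rotated]) (simp add: frechet_derivative_eq[OF d])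
  moreover have "(\<lambda>x. g (f x)) differentiable (at x)" if "x \<in> S" for x
    using d[OF that] differentiable_def by blast
  ultimately show ?case by simp
qed

section \<open>Closure properties of smooth functions\<close>

lemma smooth_on_cong: "open S \<Longrightarrow> (\<And>y. y \<in> S \<Longrightarrow> f y = g y) \<Longrightarrow> smooth_on S f \<Longrightarrow> smooth_on S g"
  unfolding smooth_on_def using Ck_on_cong by blast

lemma smooth_on_subset: "smooth_on S f \<Longrightarrow> T \<subseteq> S \<Longrightarrow> smooth_on T f"
  unfolding smooth_on_def using Ck_on_subset by blast

lemma smooth_on_local:
  assumes "\<And>x. x \<in> S \<Longrightarrow> \<exists>U. open U \<and> x \<in> U \<and> smooth_on U f"
  shows "smooth_on S f"
  unfolding smooth_on_def using assms Ck_on_local unfolding smooth_on_def by metis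

lemma smooth_on_const: "smooth_on S (\<lambda>x. c)"
  by (simp add: smooth_on_def Ck_on_const)

lemma smooth_on_id: "smooth_on S (\<lambda>x. x)"
  by (simp add: smooth_on_def Ck_on_id)

lemma smooth_on_bounded_linear:
  "bounded_linear L \<Longrightarrow> open S \<Longrightarrow> smooth_on S f \<Longrightarrow> smooth_on S (\<lambda>x. L (f x))"
  by (simp add: smooth_on_def Ck_on_bounded_linear)

lemma smooth_on_add:
  "open S \<Longrightarrow> smooth_on S f \<Longrightarrow> smooth_on S g \<Longrightarrow> smooth_on S (\<lambda>x. f x + g x)"
  by (simp add: smooth_on_def Ck_on_add)

lemma smooth_on_bounded_bilinear:
  "bounded_bilinear P \<Longrightarrow> open S \<Longrightarrow> smooth_on S f \<Longrightarrow> smooth_on S g \<Longrightarrow> smooth_on S (\<lambda>x. P (f x) (g x))"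
  by (simp add: smooth_on_def Ck_on_bounded_bilinear)

lemmas smooth_on_scaleR = smooth_on_bounded_bilinear[OF bounded_bilinear_scaleR]
lemmas smooth_on_inner_left = smooth_on_bounded_linear[OF bounded_linear_inner_left]

lemma smooth_on_sum:
  "open S \<Longrightarrow> (\<And>i. i \<in> I \<Longrightarrow> smooth_on S (f i)) \<Longrightarrow> smooth_on S (\<lambda>x. \<Sum>i\<in>I. f i x)"
  by (simp add: smooth_on_def Ck_on_sum)

lemma smooth_on_compose:
  fixes f :: "'a::euclidean_space \<Rightarrow> 'b::euclidean_space" and g :: "'b \<Rightarrow> 'c::real_normed_vector"
  shows "open S \<Longrightarrow> open T \<Longrightarrow> f ` S \<subseteq> T \<Longrightarrow> smooth_on T g \<Longrightarrow> smooth_on S f \<Longrightarrow> smooth_on S (\<lambda>x. g (f x))"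
  by (simp add: smooth_on_def Ck_on_compose)

lemma smooth_on_Pair:
  fixes f :: "'a::euclidean_space \<Rightarrow> 'b::real_normed_vector" and g :: "'a \<Rightarrow> 'c::real_normed_vector"
  assumes "open S" "smooth_on S f" "smooth_on S g"
  shows "smooth_on S (\<lambda>x. (f x, g x))"
proof -
  have 1: "bounded_linear (\<lambda>a::'b. (a, 0::'c))" "bounded_linear (\<lambda>a::'c. (0::'b, a))"
    by (auto intro!: bounded_linear_Pair bounded_linear_ident bounded_linear_zero)
  have "smooth_on S (\<lambda>x. (f x, 0) + (0, g x))"
    by (intro smooth_on_add assms smooth_on_bounded_linear[OF 1(1) assms(1)]
        smooth_on_bounded_linear[OF 1(2) assms(1)])
  then show ?thesis by simp
qed

lemma smooth_on_imp_differentiable: "smooth_on S f \<Longrightarrow> x \<in> S \<Longrightarrow> f differentiable (at x)"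
  unfolding smooth_on_def using Ck_on.simps(2) by blast

lemma smooth_on_has_derivative:
  "smooth_on S f \<Longrightarrow> x \<in> S \<Longrightarrow> (f has_derivative frechet_derivative f (at x)) (at x)"
  using smooth_on_imp_differentiable frechet_derivative_works by blast

lemma smooth_on_imp_continuous_on: "smooth_on S f \<Longrightarrow> continuous_on S f"
  unfolding smooth_on_def using Ck_on.simps(1) by blast

lemma smooth_on_frechet_derivative_const:
  "smooth_on S f \<Longrightarrow> smooth_on S (\<lambda>x. frechet_derivative f (at x) v)"
  unfolding smooth_on_def using Ck_on.simps(2) by blast

text \<open>Expansion over \<open>Basis\<close> passes from constant to moving vectors; this is how
  Jacobians and tensors are evaluated on vector fields later.\<close>

lemma smooth_on_linear_family:
  fixes L :: "'a::euclidean_space \<Rightarrow> 'b::euclidean_space \<Rightarrow> 'c::real_normed_vector"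
  assumes "open S" "\<And>x. x \<in> S \<Longrightarrow> linear (L x)" "\<And>b. smooth_on S (\<lambda>x. L x b)" "smooth_on S v"
  shows "smooth_on S (\<lambda>x. L x (v x))"
proof -
  have "smooth_on S (\<lambda>x. \<Sum>b\<in>Basis. (v x \<bullet> b) *\<^sub>R L x b)"
    by (intro smooth_on_sum smooth_on_scaleR smooth_on_inner_left assms)
  then show ?thesis
    by (rule smooth_on_cong[OF assms(1), rotated]) (metis assms(2) linear_euclidean_expand)
qed

text \<open>Product rule for the pairing of a linear map with a vector, in a form that can be
  iterated over the slots of a multilinear map.\<close>

lemma has_derivative_linear_family:
  fixes L :: "'a::euclidean_space \<Rightarrow> 'b::euclidean_space \<Rightarrow> 'c::real_normed_vector"
  assumes S: "open S" "x \<in> S" and lin: "\<And>x. x \<in> S \<Longrightarrow> linear (L x)"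
    and L': "\<And>b. ((\<lambda>x. L x b) has_derivative (\<lambda>h. L' h b)) (at x)" and lin': "\<And>h. linear (L' h)"
    and v: "(v has_derivative v') (at x)"
  shows "((\<lambda>x. L x (v x)) has_derivative (\<lambda>h. L' h (v x) + L x (v' h))) (at x)"
proof -
  have "((\<lambda>x. \<Sum>b\<in>Basis. (v x \<bullet> b) *\<^sub>R L x b) has_derivative
      (\<lambda>h. \<Sum>b\<in>Basis. (v x \<bullet> b) *\<^sub>R L' h b + (v' h \<bullet> b) *\<^sub>R L x b)) (at x)"
    by (intro has_derivative_sum has_derivative_scaleR L' has_derivative_inner_left v)
  moreover have "(\<Sum>b\<in>Basis. (v x \<bullet> b) *\<^sub>R L' h b + (v' h \<bullet> b) *\<^sub>R L x b) = L' h (v x) + L x (v' h)" for h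
    unfolding sum.distrib using linear_euclidean_expand[OF lin', of h "v x"]
      linear_euclidean_expand[OF lin[OF S(2)], of "v' h"] by simp
  ultimately have "((\<lambda>x. \<Sum>b\<in>Basis. (v x \<bullet> b) *\<^sub>R L x b) has_derivative (\<lambda>h. L' h (v x) + L x (v' h))) (at x)"
    by simp
  then show ?thesis
    by (rule has_derivative_transform_within_open[OF _ S]) (metis lin linear_euclidean_expand)
qed

section \<open>Symmetry of second derivatives\<close>

lemma has_real_derivative_along_line:
  fixes f :: "'a::real_normed_vector \<Rightarrow> real"
  assumes "f differentiable (at (x + a *\<^sub>R u))"
  shows "((\<lambda>a. f (x + a *\<^sub>R u)) has_real_derivative frechet_derivative f (at (x + a *\<^sub>R u)) u) (at a)"
proof -
  have "((\<lambda>a. x + a *\<^sub>R u) has_derivative (\<lambda>h. h *\<^sub>R u)) (at a)"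
    by (auto intro!: derivative_eq_intros)
  from diff_chain_at[OF this frechet_derivative_worksI[OF assms]] show ?thesis
    unfolding has_field_derivative_def
    by (simp add: o_def linear_scale[OF linear_frechet_derivative[OF assms]] mult_commute_abs)
qed

text \<open>Mean value theorem twice: along \<open>u\<close> for the difference \<open>p\<close> of
  two translates in direction \<open>v\<close>, then along \<open>v\<close> for the derivative of
  \<open>f\<close> in direction \<open>u\<close>. The bound on \<open>s\<close> keeps the whole
  parallelogram in the ball.\<close>

lemma second_difference:
  fixes f :: "'a::euclidean_space \<Rightarrow> real"
  assumes f: "smooth_on (ball x r) f" and s: "s > 0" "s * (norm u + norm v) < r"
  shows "\<exists>a\<in>{0<..<s}. \<exists>b\<in>{0<..<s}. f (x + s *\<^sub>R u + s *\<^sub>R v) - f (x + s *\<^sub>R u) - f (x + s *\<^sub>R v) + f x =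
     s * s * frechet_derivative (\<lambda>y. frechet_derivative f (at y) u) (at (x + a *\<^sub>R u + b *\<^sub>R v)) v"
proof -
  have in_ball: "x + a *\<^sub>R u + b *\<^sub>R v \<in> ball x r" if "0 \<le> a" "a \<le> s" "0 \<le> b" "b \<le> s" for a b
  proof -
    have "norm (a *\<^sub>R u + b *\<^sub>R v) \<le> a * norm u + b * norm v"
      using norm_triangle_ineq[of "a *\<^sub>R u" "b *\<^sub>R v"] that by simp
    also have "\<dots> \<le> s * (norm u + norm v)"
      unfolding distrib_left using that by (intro add_mono mult_right_mono) auto
    finally show ?thesis using s(2) norm_minus_commute by (simp add: dist_norm norm_minus_commute algebra_simps)
  qed
  have D: "f differentiable (at (x + a *\<^sub>R u + b *\<^sub>R v))"
    "(\<lambda>y. frechet_derivative f (at y) u) differentiable (at (x + a *\<^sub>R u + b *\<^sub>R v))"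
    if "0 \<le> a" "a \<le> s" "0 \<le> b" "b \<le> s" for a b
    using smooth_on_imp_differentiable[OF f in_ball[OF that]]
      smooth_on_imp_differentiable[OF smooth_on_frechet_derivative_const[OF f] in_ball[OF that]] by auto
  define p where "p a = f (x + a *\<^sub>R u + s *\<^sub>R v) - f (x + a *\<^sub>R u)" for a
  have p': "(p has_real_derivative frechet_derivative f (at (x + a *\<^sub>R u + s *\<^sub>R v)) u
        - frechet_derivative f (at (x + a *\<^sub>R u)) u) (at a)" if "0 \<le> a" "a \<le> s" for a
  proof -
    have eq: "x + b *\<^sub>R u + s *\<^sub>R v = (x + s *\<^sub>R v) + b *\<^sub>R u" for b by simp
    show ?thesis unfolding p_def eq
      by (intro DERIV_diff has_real_derivative_along_line)
        (use D(1)[of a s] D(1)[of a 0] that s in \<open>auto simp: eq\<close>)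
  qed
  obtain a where a: "0 < a" "a < s" "p s - p 0 = (s - 0) * (frechet_derivative f (at (x + a *\<^sub>R u + s *\<^sub>R v)) u
        - frechet_derivative f (at (x + a *\<^sub>R u)) u)"
    using MVT2[OF s(1) p'] by auto
  define q where "q b = frechet_derivative f (at (x + a *\<^sub>R u + b *\<^sub>R v)) u" for b
  have q': "(q has_real_derivative frechet_derivative (\<lambda>y. frechet_derivative f (at y) u)
     (at (x + a *\<^sub>R u + b *\<^sub>R v)) v) (at b)" if "0 \<le> b" "b \<le> s" for b
    unfolding q_def
    by (intro has_real_derivative_along_line[where f="\<lambda>y. frechet_derivative f (at y) u"])
       (use D(2) a that in auto)
  obtain b where b: "0 < b" "b < s" "q s - q 0 = (s - 0) * frechet_derivative (\<lambda>y. frechet_derivative f (at y) u)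
     (at (x + a *\<^sub>R u + b *\<^sub>R v)) v"
    using MVT2[OF s(1) q'] by auto
  have "p s - p 0 = s * (q s - q 0)" using a by (simp add: q_def)
  then have "p s - p 0 = s * s * frechet_derivative (\<lambda>y. frechet_derivative f (at y) u)
     (at (x + a *\<^sub>R u + b *\<^sub>R v)) v" using b by simp
  then have "f (x + s *\<^sub>R u + s *\<^sub>R v) - f (x + s *\<^sub>R u) - f (x + s *\<^sub>R v) + f x = s * s *
     frechet_derivative (\<lambda>y. frechet_derivative f (at y) u) (at (x + a *\<^sub>R u + b *\<^sub>R v)) v"
    by (simp add: p_def)
  then show ?thesis using a(1,2) b(1,2) by (intro bexI[of _ a] bexI[of _ b]) auto
qed

text \<open>The second difference is symmetric in \<open>u\<close> and \<open>v\<close>, so it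
  equals s^2 times either mixed derivative, each at some point near \<open>x\<close>; continuity of
  both rules out different values at \<open>x\<close>.\<close>

lemma frechet_derivative_commute_real:
  fixes f :: "'a::euclidean_space \<Rightarrow> real"
  assumes S: "open S" "x \<in> S" and f: "smooth_on S f"
  shows "frechet_derivative (\<lambda>y. frechet_derivative f (at y) u) (at x) v =
         frechet_derivative (\<lambda>y. frechet_derivative f (at y) v) (at x) u"
proof (rule ccontr)
  define P where "P y = frechet_derivative (\<lambda>y. frechet_derivative f (at y) u) (at y) v" for y
  define Q where "Q y = frechet_derivative (\<lambda>y. frechet_derivative f (at y) v) (at y) u" for y
  assume "\<not> ?thesis"
  then have ne: "P x \<noteq> Q x" by (simp add: P_def Q_def)
  \<comment> \<open>Half the gap: a value within \<open>e\<close> of \<open>P x\<close> cannot also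
    lie within \<open>e\<close> of \<open>Q x\<close>.\<close>
  define e where "e = dist (P x) (Q x) / 2"
  have e: "e > 0" using ne by (simp add: e_def)
  obtain r where r: "r > 0" "ball x r \<subseteq> S" using S openE by blast
  have fr: "smooth_on (ball x r) f" using f r(2) smooth_on_subset by blast
  have "isCont P x" "isCont Q x"
    using smooth_on_imp_continuous_on[OF smooth_on_frechet_derivative_const[OF smooth_on_frechet_derivative_const[OF f]]] S
    unfolding P_def Q_def by (auto simp: continuous_on_eq_continuous_at)
  then obtain d1 d2 where d: "d1 > 0" "d2 > 0" "\<And>y. dist y x < d1 \<Longrightarrow> dist (P y) (P x) < e"
    "\<And>y. dist y x < d2 \<Longrightarrow> dist (Q y) (Q x) < e"
    using e unfolding continuous_at_eps_delta by metis
  define R where "R = min r (min d1 d2)"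
  \<comment> \<open>The summand 1 avoids a division by zero, and the half keeps the parallelogram
    strictly within distance \<open>R\<close> of \<open>x\<close>.\<close>
  define s where "s = R / (norm u + norm v + 1) / 2"
  have R: "R > 0" using r d by (simp add: R_def)
  have pos: "norm u + norm v + 1 > 0" using norm_ge_zero[of u] norm_ge_zero[of v] by linarith
  have s0: "s > 0" using R pos by (simp add: s_def)
  have s1: "s * (norm u + norm v) < R"
  proof -
    have "s * (norm u + norm v) \<le> s * (norm u + norm v + 1)" using s0 by simp
    also have "\<dots> = R / 2"
    proof -
      have "R / D / 2 * D = R / 2" if "D > 0" for D :: real using that by simp
      then show ?thesis using pos unfolding s_def by blast
    qed
    finally show ?thesis using R by simp
  qed
  have near: "dist (x + a *\<^sub>R w + b *\<^sub>R z) x < R" if "a \<in> {0<..<s}" "b \<in> {0<..<s}" "norm w + norm z = norm u + norm v" for a b w z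
  proof -
    have "dist (x + a *\<^sub>R w + b *\<^sub>R z) x = norm (a *\<^sub>R w + b *\<^sub>R z)" by (simp add: dist_norm add.assoc)
    also have "\<dots> \<le> a * norm w + b * norm z"
      using norm_triangle_ineq[of "a *\<^sub>R w" "b *\<^sub>R z"] that by simp
    also have "\<dots> \<le> s * norm w + s * norm z" using that by (intro add_mono mult_right_mono) auto
    also have "\<dots> < R" using s1 that(3) by (simp add: distrib_left[symmetric])
    finally show ?thesis .
  qed
  obtain a b where ab: "a \<in> {0<..<s}" "b \<in> {0<..<s}" "f (x + s *\<^sub>R u + s *\<^sub>R v) - f (x + s *\<^sub>R u) - f (x + s *\<^sub>R v) + f x =
     s * s * P (x + a *\<^sub>R u + b *\<^sub>R v)"
    using second_difference[OF fr s0, of u v] s1 unfolding P_def R_def by auto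
  obtain a' b' where ab': "a' \<in> {0<..<s}" "b' \<in> {0<..<s}" "f (x + s *\<^sub>R v + s *\<^sub>R u) - f (x + s *\<^sub>R v) - f (x + s *\<^sub>R u) + f x =
     s * s * Q (x + a' *\<^sub>R v + b' *\<^sub>R u)"
    using second_difference[OF fr s0, of v u] s1 unfolding Q_def R_def by (auto simp: add.commute)
  have "f (x + s *\<^sub>R v + s *\<^sub>R u) = f (x + s *\<^sub>R u + s *\<^sub>R v)" by (simp add: add.commute add.left_commute)
  then have "s * s * P (x + a *\<^sub>R u + b *\<^sub>R v) = s * s * Q (x + a' *\<^sub>R v + b' *\<^sub>R u)"
    using ab(3) ab'(3) by linarith
  then have "P (x + a *\<^sub>R u + b *\<^sub>R v) = Q (x + a' *\<^sub>R v + b' *\<^sub>R u)" using s0 by simp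
  moreover have "dist (P (x + a *\<^sub>R u + b *\<^sub>R v)) (P x) < e" "dist (Q (x + a' *\<^sub>R v + b' *\<^sub>R u)) (Q x) < e"
    using near[OF ab(1,2), of u v] near[OF ab'(1,2), of v u] d(3,4) by (auto simp: R_def add.commute)
  ultimately have "dist (P x) (Q x) < 2 * e"
    using dist_triangle_half_r[of "P (x + a *\<^sub>R u + b *\<^sub>R v)" "P x" "2 * e" "Q x"] by simp
  then show False by (simp add: e_def)
qed

lemma frechet_derivative_inner:
  assumes "f differentiable (at x)"
  shows "frechet_derivative (\<lambda>y. f y \<bullet> b) (at x) v = frechet_derivative f (at x) v \<bullet> b"
  by (rule frechet_derivative_eq) (intro has_derivative_inner_left frechet_derivative_worksI assms)

text \<open>The mean value argument concerns real functions, so the vector case goes through the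
  components \<open>f y \<bullet> b\<close>.\<close>

lemma frechet_derivative_commute:
  fixes f :: "'a::euclidean_space \<Rightarrow> 'b::euclidean_space"
  assumes S: "open S" "x \<in> S" and f: "smooth_on S f"
  shows "frechet_derivative (\<lambda>y. frechet_derivative f (at y) u) (at x) v =
         frechet_derivative (\<lambda>y. frechet_derivative f (at y) v) (at x) u"
proof (rule euclidean_eqI)
  fix b :: 'b
  have D2: "frechet_derivative (\<lambda>y. frechet_derivative f (at y) w) (at x) z \<bullet> b =
    frechet_derivative (\<lambda>y. frechet_derivative (\<lambda>y. f y \<bullet> b) (at y) w) (at x) z" for w z
  proof -
    note d = smooth_on_imp_differentiable[OF smooth_on_frechet_derivative_const[OF f] S(2)]
    have "frechet_derivative (\<lambda>y. frechet_derivative f (at y) w \<bullet> b) (at x) =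
        frechet_derivative (\<lambda>y. frechet_derivative (\<lambda>y. f y \<bullet> b) (at y) w) (at x)"
      by (rule frechet_derivative_cong_open[OF S])
         (rule frechet_derivative_inner[OF smooth_on_imp_differentiable[OF f], symmetric])
    then show ?thesis using frechet_derivative_inner[OF d, of w b z] by (simp only:)
  qed
  show "frechet_derivative (\<lambda>y. frechet_derivative f (at y) u) (at x) v \<bullet> b =
         frechet_derivative (\<lambda>y. frechet_derivative f (at y) v) (at x) u \<bullet> b"
    unfolding D2 by (rule frechet_derivative_commute_real[OF S smooth_on_inner_left[OF S(1) f]])
qed

section \<open>Charts and coordinates\<close>

lemma chart_inv_in_dom: "x \<in> chart_image c \<Longrightarrow> chart_inv c x \<in> chart_dom c"
  by (rule inv_into_into)

lemma chart_map_inv: "x \<in> chart_image c \<Longrightarrow> chart_map c (chart_inv c x) = x"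
  by (rule f_inv_into_f)

lemma chart_inv_map: "is_chart c \<Longrightarrow> p \<in> chart_dom c \<Longrightarrow> chart_inv c (chart_map c p) = p"
  unfolding is_chart_def homeomorphism_def by blast

lemma open_chart_dom: "is_chart c \<Longrightarrow> open (chart_dom c)"
  and open_chart_image: "is_chart c \<Longrightarrow> open (chart_image c)"
  unfolding is_chart_def by auto

lemma open_chart_map_image:
  assumes c: "is_chart c" and U: "open U"
  shows "open (chart_map c ` (chart_dom c \<inter> U))"
proof -
  have "openin (top_of_set (chart_image c)) (chart_map c ` (chart_dom c \<inter> U))"
    using c U unfolding is_chart_def
    by (intro homeomorphism_imp_open_map[of "chart_dom c" _ _ "chart_inv c"]) (auto intro: openin_open_Int)
  then show ?thesis using open_chart_image[OF c] openin_open_trans by blast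
qed

lemma continuous_on_chart_map: "is_chart c \<Longrightarrow> continuous_on (chart_dom c) (chart_map c)"
  and continuous_on_chart_inv: "is_chart c \<Longrightarrow> continuous_on (chart_image c) (chart_inv c)"
  unfolding is_chart_def homeomorphism_def by auto

text \<open>Jacobian of the coordinate change. \<open>from_coords\<close> and
  \<open>to_coords\<close> are the instances in which one of the charts is the chosen one, so the
  chain rule is proved once for all of them.\<close>

definition dtrans :: "('m, 'e::euclidean_space) chart \<Rightarrow> ('m, 'e) chart \<Rightarrow> 'm \<Rightarrow> 'e \<Rightarrow> 'e" where
  "dtrans c d p = frechet_derivative (transition c d) (at (chart_map c p))"

lemma from_coords_eq_dtrans: "from_coords A c p = dtrans c (chart_at A p) p"
  and to_coords_eq_dtrans: "to_coords A c p = dtrans (chart_at A p) c p"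
  by (auto simp: from_coords_def to_coords_def dtrans_def)

lemma compatible_sym: "compatible c d \<Longrightarrow> compatible d c"
  unfolding compatible_def by (simp add: Int_commute)

lemma smooth_on_transition:
  "compatible c d \<Longrightarrow> smooth_on (chart_map c ` (chart_dom c \<inter> chart_dom d)) (transition c d)"
  unfolding compatible_def by simp

lemma transition_has_derivative:
  "compatible c d \<Longrightarrow> p \<in> chart_dom c \<Longrightarrow> p \<in> chart_dom d \<Longrightarrow>
   (transition c d has_derivative dtrans c d p) (at (chart_map c p))"
  unfolding dtrans_def by (rule smooth_on_has_derivative[OF smooth_on_transition]) auto

lemma linear_dtrans:
  "compatible c d \<Longrightarrow> p \<in> chart_dom c \<Longrightarrow> p \<in> chart_dom d \<Longrightarrow> linear (dtrans c d p)"
  using transition_has_derivative has_derivative_linear by blast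

lemma transition_chart_map:
  "is_chart c \<Longrightarrow> p \<in> chart_dom c \<Longrightarrow> transition c d (chart_map c p) = chart_map d p"
  by (simp add: transition_def chart_inv_map)

lemma dtrans_self:
  assumes "is_chart c" "p \<in> chart_dom c"
  shows "dtrans c c p v = v"
proof -
  have "(transition c c has_derivative (\<lambda>v. v)) (at (chart_map c p))"
    by (rule has_derivative_transform_within_open[OF has_derivative_ident open_chart_image[OF assms(1)]])
       (use assms(2) in \<open>auto simp: transition_def chart_map_inv\<close>)
  then show ?thesis unfolding dtrans_def by (rule frechet_derivative_eq)
qed

lemma dtrans_trans:
  assumes ch: "is_chart c" "is_chart d" "is_chart e" and comp: "compatible c d" "compatible d e"
    and p: "p \<in> chart_dom c" "p \<in> chart_dom d" "p \<in> chart_dom e"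
  shows "dtrans c e p v = dtrans d e p (dtrans c d p v)"
proof -
  \<comment> \<open>On the image of the triple overlap the composite of the two coordinate changes
    is literally the third one.\<close>
  let ?U = "chart_map c ` (chart_dom c \<inter> (chart_dom d \<inter> chart_dom e))"
  have "(transition d e has_derivative dtrans d e p) (at (transition c d (chart_map c p)))"
    using transition_has_derivative[OF comp(2) p(2,3)] by (simp add: transition_chart_map ch p)
  from diff_chain_at[OF transition_has_derivative[OF comp(1) p(1,2)] this]
  have "(transition c e has_derivative dtrans d e p \<circ> dtrans c d p) (at (chart_map c p))"
    by (rule has_derivative_transform_within_open[where s = ?U])
       (use ch p in \<open>auto intro!: open_chart_map_image open_Int open_chart_dom
          simp: transition_def chart_inv_map\<close>)
  then show ?thesis by (simp add: frechet_derivative_eq dtrans_def)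
qed

lemma dtrans_inverse:
  assumes "is_chart c" "is_chart d" "compatible c d" "p \<in> chart_dom c" "p \<in> chart_dom d"
  shows "dtrans d c p (dtrans c d p v) = v"
  using dtrans_trans[OF assms(1,2,1,3) compatible_sym[OF assms(3)] assms(4,5,4), of v]
    dtrans_self[OF assms(1,4)] by simp

lemma smooth_atlasD:
  assumes "smooth_atlas A"
  shows "c \<in> A \<Longrightarrow> is_chart c" "c \<in> A \<Longrightarrow> d \<in> A \<Longrightarrow> compatible c d" "\<exists>c\<in>A. p \<in> chart_dom c"
  using assms unfolding smooth_atlas_def by blast+

lemma chart_at:
  assumes "smooth_atlas A"
  shows "chart_at A p \<in> A" "p \<in> chart_dom (chart_at A p)"
  using someI_ex[of "\<lambda>c. c \<in> A \<and> p \<in> chart_dom c"] smooth_atlasD(3)[OF assms, of p]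
  unfolding chart_at_def by blast+

lemma smooth_chartI: "smooth_atlas A \<Longrightarrow> c \<in> A \<Longrightarrow> smooth_chart A c"
  unfolding smooth_chart_def using smooth_atlasD by blast

context
  fixes A :: "('m::{t2_space,second_countable_topology}, 'e::euclidean_space) chart set"
  assumes A: "smooth_atlas A"
begin

lemma chart_at_compat:
  assumes "smooth_chart A c"
  shows "is_chart c" "is_chart (chart_at A p)" "compatible c (chart_at A p)"
    "compatible (chart_at A p) c"
proof -
  note a = chart_at(1)[OF A, of p]
  show "is_chart c" "is_chart (chart_at A p)" "compatible c (chart_at A p)"
    using assms a smooth_atlasD(1)[OF A] unfolding smooth_chart_def by simp_all
  then show "compatible (chart_at A p) c" by (rule_tac compatible_sym)
qed

context
  fixes c p
  assumes c: "smooth_chart A c" and p: "p \<in> chart_dom c"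
begin

lemma linear_from_coords: "linear (from_coords A c p)"
  unfolding from_coords_eq_dtrans
  by (rule linear_dtrans[OF chart_at_compat(3)[OF c] p chart_at(2)[OF A]])

lemma linear_to_coords: "linear (to_coords A c p)"
  unfolding to_coords_eq_dtrans
  by (rule linear_dtrans[OF chart_at_compat(4)[OF c] chart_at(2)[OF A] p])

lemma to_from_coords: "to_coords A c p (from_coords A c p v) = v"
  unfolding to_coords_eq_dtrans from_coords_eq_dtrans
  by (rule dtrans_inverse[OF chart_at_compat(1-3)[OF c] p chart_at(2)[OF A]])

lemma from_to_coords: "from_coords A c p (to_coords A c p v) = v"
  unfolding to_coords_eq_dtrans from_coords_eq_dtrans
  by (rule dtrans_inverse[OF chart_at_compat(2,1,4)[OF c] chart_at(2)[OF A] p])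

end

lemma from_coords_dtrans:
  assumes "smooth_chart A c" "smooth_chart A d" "compatible c d" "p \<in> chart_dom c" "p \<in> chart_dom d"
  shows "from_coords A d p (dtrans c d p v) = from_coords A c p v"
  unfolding from_coords_eq_dtrans
  by (rule dtrans_trans[OF chart_at_compat(1)[OF assms(1)] chart_at_compat(1,2)[OF assms(2)] assms(3)
        chart_at_compat(3)[OF assms(2)] assms(4,5) chart_at(2)[OF A], symmetric])

lemma to_coords_from_coords:
  assumes "smooth_chart A c" "smooth_chart A d" "compatible c d" "p \<in> chart_dom c" "p \<in> chart_dom d"
  shows "to_coords A d p (from_coords A c p v) = dtrans c d p v"
  using from_coords_dtrans[OF assms, of v] to_from_coords[OF assms(2,5), of "dtrans c d p v"] by simp

text \<open>A vector at \<open>p\<close> is by definition its component vector in the chosen chart.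
  As \<open>ext_deriv\<close> is computed in that chart, its values can be compared with components
  directly.\<close>

lemma from_coords_chart_at: "from_coords A (chart_at A p) p v = v"
  unfolding from_coords_eq_dtrans
  by (rule dtrans_self[OF smooth_atlasD(1)[OF A chart_at(1)[OF A]] chart_at(2)[OF A]])

end

section \<open>Differentials and velocities in arbitrary charts\<close>

lemma isCont_open_preimage:
  assumes "isCont f p" "open V" "f p \<in> V"
  obtains U where "open U" "p \<in> U" "f ` U \<subseteq> V"
proof -
  have "\<exists>U. open U \<and> p \<in> U \<and> (\<forall>x\<in>U. f x \<in> V)"
    using assms unfolding continuous_at_open by simp
  then show thesis using that by blast
qed

text \<open>The definition reads the differential in the chosen charts at \<open>p\<close> and
  \<open>f p\<close>. That representative factors into a coordinate change, the representative in
  \<open>c\<close> and \<open>d\<close>, and a coordinate change; the chain rule then frees later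
  arguments from the choice.\<close>

lemma tangent_map_coords:
  assumes A: "smooth_atlas A" and B: "smooth_atlas B" and c: "c \<in> A" "p \<in> chart_dom c"
    and d: "d \<in> B" "f p \<in> chart_dom d" and f: "isCont f p"
    and F': "((chart_map d \<circ> f \<circ> chart_inv c) has_derivative F') (at (chart_map c p))"
  shows "tangent_map A B f p (from_coords A c p u) = from_coords B d (f p) (F' u)"
    and "linear (tangent_map A B f p)"
proof -
  let ?a = "chart_at A p" and ?b = "chart_at B (f p)"
  note a = chart_at[OF A, of p] and b = chart_at[OF B, of "f p"]
  note ch = smooth_atlasD(1)[OF A a(1)] smooth_atlasD(1)[OF A c(1)]
    smooth_atlasD(1)[OF B b(1)] smooth_atlasD(1)[OF B d(1)]
  note comp = smooth_atlasD(2)[OF A a(1) c(1)] smooth_atlasD(2)[OF A c(1) a(1)]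
    smooth_atlasD(2)[OF B d(1) b(1)]
  obtain U where U: "open U" "p \<in> U" "f ` U \<subseteq> chart_dom d"
    by (rule isCont_open_preimage[OF f open_chart_dom[OF ch(4)] d(2)])
  \<comment> \<open>For these points \<open>f\<close> stays in the domain of \<open>d\<close>, so
    that the inserted inverse charts cancel.\<close>
  let ?V = "chart_map ?a ` (chart_dom ?a \<inter> (chart_dom c \<inter> U))"
  have "(chart_map d \<circ> f \<circ> chart_inv c has_derivative F') (at (transition ?a c (chart_map ?a p)))"
    using F' by (simp add: transition_chart_map ch a)
  from diff_chain_at[OF transition_has_derivative[OF comp(1) a(2) c(2)] this]
  have 1: "((chart_map d \<circ> f \<circ> chart_inv c) \<circ> transition ?a c has_derivative F' \<circ> dtrans ?a c p) (at (chart_map ?a p))" .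
  have "(transition d ?b has_derivative dtrans d ?b (f p))
      (at (((chart_map d \<circ> f \<circ> chart_inv c) \<circ> transition ?a c) (chart_map ?a p)))"
    using transition_has_derivative[OF comp(3) d(2) b(2)] by (simp add: transition_chart_map chart_inv_map ch a c)
  from diff_chain_at[OF 1 this]
  have G: "((chart_map ?b \<circ> f \<circ> chart_inv ?a) has_derivative
      dtrans d ?b (f p) \<circ> (F' \<circ> dtrans ?a c p)) (at (chart_map ?a p))"
    by (rule has_derivative_transform_within_open[where s = ?V])
       (use U ch a c in \<open>auto intro!: open_chart_map_image open_Int open_chart_dom
          simp: transition_def chart_inv_map image_subset_iff\<close>)
  then have eq: "tangent_map A B f p v = dtrans d ?b (f p) (F' (dtrans ?a c p v))" for v
    unfolding tangent_map_def using frechet_derivative_eq[OF G] by simp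
  have eq': "tangent_map A B f p = dtrans d ?b (f p) \<circ> (F' \<circ> dtrans ?a c p)" by (simp add: eq fun_eq_iff)
  show "tangent_map A B f p (from_coords A c p u) = from_coords B d (f p) (F' u)"
    unfolding eq from_coords_eq_dtrans by (simp add: dtrans_inverse ch a c comp)
  show "linear (tangent_map A B f p)"
    unfolding eq' by (rule has_derivative_linear[OF G])
qed

lemma velocity_coords:
  assumes B: "smooth_atlas B" and d: "d \<in> B" "\<gamma> t \<in> chart_dom d" and \<gamma>: "isCont \<gamma> t"
    and w: "((\<lambda>s. chart_map d (\<gamma> s)) has_vector_derivative w) (at t)"
  shows "velocity B \<gamma> t = from_coords B d (\<gamma> t) w"
proof -
  let ?b = "chart_at B (\<gamma> t)"
  note b = chart_at[OF B, of "\<gamma> t"]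
  note ch = smooth_atlasD(1)[OF B b(1)] smooth_atlasD(1)[OF B d(1)]
  note comp = smooth_atlasD(2)[OF B d(1) b(1)]
  obtain U where U: "open U" "t \<in> U" "\<gamma> ` U \<subseteq> chart_dom d"
    using isCont_open_preimage[of t \<gamma> "chart_dom d"] \<gamma> open_chart_dom[OF ch(2)] d(2) by blast
  have "((\<lambda>s. chart_map d (\<gamma> s)) has_derivative (\<lambda>h. h *\<^sub>R w)) (at t)"
    using w by (simp add: has_vector_derivative_def)
  from diff_chain_at[OF this transition_has_derivative[OF comp d(2) b(2)]]
  have "((chart_map ?b \<circ> \<gamma>) has_derivative dtrans d ?b (\<gamma> t) \<circ> (\<lambda>h. h *\<^sub>R w)) (at t)"
    by (rule has_derivative_transform_within_open[where s = U])
       (use U ch in \<open>auto simp: transition_def chart_inv_map image_subset_iff\<close>)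
  moreover have "dtrans d ?b (\<gamma> t) \<circ> (\<lambda>h. h *\<^sub>R w) = (\<lambda>h. h *\<^sub>R dtrans d ?b (\<gamma> t) w)"
    by (auto simp: linear_scale[OF linear_dtrans[OF comp d(2) b(2)]])
  ultimately have "((chart_map ?b \<circ> \<gamma>) has_vector_derivative dtrans d ?b (\<gamma> t) w) (at t)"
    by (simp add: has_vector_derivative_def)
  then show ?thesis unfolding velocity_def from_coords_eq_dtrans by (rule vector_derivative_at)
qed

section \<open>Smooth families of bilinear forms\<close>

text \<open>A 2-tensor in a chart: the base point comes first, then two vectors. Both the metric
  \<open>h\<close> and the form \<omega> are instances.\<close>

locale smooth_bilinear =
  fixes T :: "'f::euclidean_space set" and W :: "'f \<Rightarrow> 'f \<Rightarrow> 'f \<Rightarrow> real"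
  assumes open_T: "open T"
    and lin1: "\<And>y v. y \<in> T \<Longrightarrow> linear (\<lambda>u. W y u v)"
    and lin2: "\<And>y u. y \<in> T \<Longrightarrow> linear (W y u)"
    and smooth: "\<And>u v. smooth_on T (\<lambda>y. W y u v)"
begin

definition WD :: "'f \<Rightarrow> 'f \<Rightarrow> 'f \<Rightarrow> 'f \<Rightarrow> real" where
  "WD y k u v = frechet_derivative (\<lambda>y. W y u v) (at y) k"

lemma WD_has_derivative: "y \<in> T \<Longrightarrow> ((\<lambda>y. W y u v) has_derivative (\<lambda>k. WD y k u v)) (at y)"
  using smooth_on_has_derivative[OF smooth] unfolding WD_def .

lemma WD_eqI:
  assumes "y \<in> T" "((\<lambda>y. W y u v) has_derivative F) (at y)"
  shows "WD y k u v = F k"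
  unfolding WD_def using frechet_derivative_eq[OF assms(2)] .

text \<open>Linearity holds at all points of the open set \<open>T\<close>, so it survives
  differentiation in the base point by uniqueness of derivatives.\<close>

lemma WD_lin1: assumes "y \<in> T" shows "linear (\<lambda>u. WD y k u v)"
proof (rule linearI)
  note tr = has_derivative_transform_within_open[OF _ open_T assms]
  fix u u' :: 'f and r :: real
  show "WD y k (u + u') v = WD y k u v + WD y k u' v"
    by (rule WD_eqI[OF assms])
      (rule tr[OF has_derivative_add[OF WD_has_derivative[OF assms, of u v] WD_has_derivative[OF assms, of u' v]]],
        simp add: linear_add[OF lin1])
  show "WD y k (r *\<^sub>R u) v = r *\<^sub>R WD y k u v"
    by (rule WD_eqI[OF assms])
      (rule tr[OF has_derivative_scaleR_right[OF WD_has_derivative[OF assms, of u v]]],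
        simp add: linear_scale[OF lin1])
qed

lemma WD_lin2: assumes "y \<in> T" shows "linear (WD y k u)"
proof (rule linearI)
  note tr = has_derivative_transform_within_open[OF _ open_T assms]
  fix v v' :: 'f and r :: real
  show "WD y k u (v + v') = WD y k u v + WD y k u v'"
    by (rule WD_eqI[OF assms])
      (rule tr[OF has_derivative_add[OF WD_has_derivative[OF assms, of u v] WD_has_derivative[OF assms, of u v']]],
        simp add: linear_add[OF lin2])
  show "WD y k u (r *\<^sub>R v) = r *\<^sub>R WD y k u v"
    by (rule WD_eqI[OF assms])
      (rule tr[OF has_derivative_scaleR_right[OF WD_has_derivative[OF assms, of u v]]],
        simp add: linear_scale[OF lin2])
qed

lemma smooth_on_comp:
  fixes F U V :: "'z::euclidean_space \<Rightarrow> 'f"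
  assumes S: "open S" "F ` S \<subseteq> T" and "smooth_on S F" "smooth_on S U" "smooth_on S V"
  shows "smooth_on S (\<lambda>z. W (F z) (U z) (V z))"
proof (rule smooth_on_linear_family[OF S(1) _ _ assms(5)])
  show "linear (W (F z) (U z))" if "z \<in> S" for z using lin2 S(2) that by blast
  show "smooth_on S (\<lambda>z. W (F z) (U z) b)" for b
  proof (rule smooth_on_linear_family[OF S(1) _ _ assms(4), where L="\<lambda>z u. W (F z) u b"])
    show "linear (\<lambda>u. W (F z) u b)" if "z \<in> S" for z using lin1 S(2) that by blast
    show "smooth_on S (\<lambda>z. W (F z) b' b)" for b'
      by (rule smooth_on_compose[OF S(1) open_T S(2) smooth assms(3)])
  qed
qed

text \<open>Three things move with \<open>z\<close>: the base point and both slots. The chain rule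
  handles the first, and the product rule for linear families is applied once for each slot.\<close>

lemma has_derivative_comp:
  fixes F U V :: "'z::euclidean_space \<Rightarrow> 'f"
  assumes S: "open S" "F ` S \<subseteq> T" "z \<in> S"
    and F: "(F has_derivative F') (at z)" and U: "(U has_derivative U') (at z)" and V: "(V has_derivative V') (at z)"
  shows "((\<lambda>z. W (F z) (U z) (V z)) has_derivative
     (\<lambda>h. WD (F z) (F' h) (U z) (V z) + W (F z) (U' h) (V z) + W (F z) (U z) (V' h))) (at z)"
proof -
  have Fz: "F z \<in> T" using S by auto
  have 1: "((\<lambda>z. W (F z) u v) has_derivative (\<lambda>h. WD (F z) (F' h) u v)) (at z)" for u v
    using diff_chain_at[OF F WD_has_derivative[OF Fz, of u v]] by (simp add: o_def)
  have 2: "((\<lambda>z. W (F z) (U z) v) has_derivative (\<lambda>h. WD (F z) (F' h) (U z) v + W (F z) (U' h) v)) (at z)" for v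
    by (rule has_derivative_linear_family[OF S(1,3) _ _ _ U, where L="\<lambda>z u. W (F z) u v"])
       (use lin1 S(2) WD_lin1[OF Fz] 1 in auto)
  show ?thesis
    by (rule has_derivative_linear_family[OF S(1,3) _ _ _ V, where L="\<lambda>z. W (F z) (U z)"])
       (use lin2 S(2) Fz 2 in \<open>auto intro!: linear_compose_add WD_lin2\<close>)
qed

end

section \<open>Variations of a map\<close>

lemma smooth_tensor2_linear:
  assumes "smooth_tensor B 2 \<omega>"
  shows "linear (\<lambda>u. \<omega> q [u, v])" "linear (\<lambda>v. \<omega> q [u, v])"
proof -
  have *: "length vs = 2 \<Longrightarrow> i < 2 \<Longrightarrow> linear (\<lambda>u. \<omega> q (vs[i := u]))" for vs i
    using assms unfolding smooth_tensor_def by blast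
  show "linear (\<lambda>u. \<omega> q [u, v])" using *[of "[0, v]" 0] by simp
  show "linear (\<lambda>v. \<omega> q [u, v])" using *[of "[u, 0]" 1] by simp
qed

lemma smooth_bilinear_tensor_coords:
  assumes B: "smooth_atlas B" and d: "d \<in> B" and \<omega>: "smooth_tensor B 2 \<omega>"
  shows "smooth_bilinear (chart_image d) (\<lambda>y u v. tensor_coords B d \<omega> y [u, v])"
proof -
  note sc = smooth_chartI[OF B d]
  have "open (chart_image d)" using open_chart_image smooth_atlasD(1)[OF B d] by blast
  moreover have "smooth_on (chart_image d) (\<lambda>y. tensor_coords B d \<omega> y [u, v])" for u v
    using \<omega> d unfolding smooth_tensor_def by simp
  moreover have "linear (\<lambda>u. tensor_coords B d \<omega> y [u, v])" if "y \<in> chart_image d" for y v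
    using linear_compose[OF linear_from_coords[OF B sc chart_inv_in_dom[OF that]] smooth_tensor2_linear(1)[OF \<omega>]]
    unfolding tensor_coords_def by (simp add: o_def)
  moreover have "linear (\<lambda>v. tensor_coords B d \<omega> y [u, v])" if "y \<in> chart_image d" for y u
    using linear_compose[OF linear_from_coords[OF B sc chart_inv_in_dom[OF that]] smooth_tensor2_linear(2)[OF \<omega>]]
    unfolding tensor_coords_def by (simp add: o_def)
  ultimately show ?thesis by (simp add: smooth_bilinear_def)
qed

lemma list_length_2: "length vs = 2 \<longleftrightarrow> (\<exists>u v. vs = [u, v])"
  by (auto simp: numeral_2_eq_2 length_Suc_conv)

lemma list_length_1: "length vs = Suc 0 \<longleftrightarrow> (\<exists>v. vs = [v])"
  by (auto simp: length_Suc_conv)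

locale variation =
  fixes A :: "('m::{t2_space,second_countable_topology}, 'e::euclidean_space) chart set"
    and B :: "('n::{t2_space,second_countable_topology}, 'f::euclidean_space) chart set"
    and \<Phi> :: "real \<Rightarrow> 'm \<Rightarrow> 'n" and \<epsilon> :: real
    and \<omega> :: "('n, 'f) tensor"
  assumes A: "smooth_atlas A" and B: "smooth_atlas B" and \<epsilon>: "\<epsilon> > 0"
    and \<Phi>: "smooth_map_on (line_times A) B ({-\<epsilon><..<\<epsilon>} \<times> UNIV) (\<lambda>(t, p). \<Phi> t p)"
    and \<omega>: "smooth_form B 2 \<omega>"
begin

abbreviation "I \<equiv> {-\<epsilon><..<\<epsilon>}"

text \<open>Time is one more coordinate: in the derivative of \<open>rep\<close>, direction
  \<open>(1, 0)\<close> gives the velocity of the variation and \<open>(0, u)\<close> the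
  differential of \<open>\<Phi> t\<close>.\<close>

definition rep :: "('m, 'e) chart \<Rightarrow> ('n, 'f) chart \<Rightarrow> real \<times> 'e \<Rightarrow> 'f" where
  "rep c d z = chart_map d (\<Phi> (fst z) (chart_inv c (snd z)))"

definition rep_dom :: "('m, 'e) chart \<Rightarrow> ('n, 'f) chart \<Rightarrow> (real \<times> 'e) set" where
  "rep_dom c d = {z \<in> I \<times> chart_image c. \<Phi> (fst z) (chart_inv c (snd z)) \<in> chart_dom d}"

abbreviation "drep c d z h \<equiv> frechet_derivative (rep c d) (at z) h"

abbreviation "W d y u v \<equiv> tensor_coords B d \<omega> y [u, v]"

lemma rep_domI: "t \<in> I \<Longrightarrow> p \<in> chart_dom c \<Longrightarrow> c \<in> A \<Longrightarrow> \<Phi> t p \<in> chart_dom d \<Longrightarrow> (t, chart_map c p) \<in> rep_dom c d"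
  unfolding rep_dom_def using chart_inv_map[OF smooth_atlasD(1)[OF A, of c], of p] by simp

lemma open_rep_dom:
  assumes c: "c \<in> A" and d: "d \<in> B"
  shows "open (rep_dom c d)"
proof -
  note ch = smooth_atlasD(1)[OF A c] smooth_atlasD(1)[OF B d]
  have 1: "continuous_on (I \<times> chart_image c) (\<lambda>z. (fst z, chart_inv c (snd z)))"
    by (intro continuous_intros continuous_on_compose2[OF continuous_on_chart_inv[OF ch(1)]]) auto
  have 2: "continuous_on (I \<times> UNIV) (\<lambda>z. \<Phi> (fst z) (snd z))"
    using \<Phi> unfolding smooth_map_on_def by (simp add: case_prod_beta')
  have "continuous_on (I \<times> chart_image c) (\<lambda>z. \<Phi> (fst z) (chart_inv c (snd z)))"
    by (rule continuous_on_compose2[OF 2 1, simplified]) auto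
  from continuous_open_preimage[OF this _ open_chart_dom[OF ch(2)]] show ?thesis
    unfolding rep_dom_def by (simp add: open_Times open_chart_image[OF ch(1)] Collect_conj_eq vimage_def)
qed

lemma smooth_on_rep:
  assumes c: "c \<in> A" and d: "d \<in> B"
  shows "smooth_on (rep_dom c d) (rep c d)"
proof -
  note ch = smooth_atlasD(1)[OF A c] smooth_atlasD(1)[OF B d]
  \<comment> \<open>The chart of the product atlas belonging to \<open>c\<close>. Its inverse is an
    \<open>inv_into\<close> on the product, which injectivity identifies with the product of the
    inverses.\<close>
  define c' where "c' = ((UNIV :: real set) \<times> chart_dom c, map_prod id (chart_map c) :: real \<times> 'm \<Rightarrow> _)"
  have inj: "inj_on (map_prod id (chart_map c)) ((UNIV :: real set) \<times> chart_dom c)"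
    by (rule inj_onI) (auto, metis chart_inv_map[OF ch(1)])
  have inv: "chart_inv c' z = (fst z, chart_inv c (snd z))" if "snd z \<in> chart_image c" for z
    using inv_into_f_f[OF inj, of "(fst z, chart_inv c (snd z))"] chart_inv_in_dom[OF that] chart_map_inv[OF that]
    by (simp add: c'_def)
  have set: "chart_map c' ` {p \<in> I \<times> UNIV \<inter> chart_dom c'. (\<lambda>(t, p). \<Phi> t p) p \<in> chart_dom d} = rep_dom c d"
  proof (intro set_eqI iffI)
    fix z assume "z \<in> rep_dom c d"
    then show "z \<in> chart_map c' ` {p \<in> I \<times> UNIV \<inter> chart_dom c'. (\<lambda>(t, p). \<Phi> t p) p \<in> chart_dom d}"
      using chart_inv_in_dom[of "snd z" c] chart_map_inv[of "snd z" c]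
      by (intro image_eqI[of _ _ "(fst z, chart_inv c (snd z))"]) (auto simp: rep_dom_def c'_def)
  qed (auto simp: rep_dom_def c'_def chart_inv_map[OF ch(1)])
  have c': "c' \<in> line_times A" unfolding c'_def line_times_def using c by blast
  have "\<forall>c\<in>line_times A. \<forall>d\<in>B. smooth_on (chart_map c ` {p \<in> I \<times> UNIV \<inter> chart_dom c. (\<lambda>(t, p). \<Phi> t p) p \<in> chart_dom d})
     (chart_map d \<circ> (\<lambda>(t, p). \<Phi> t p) \<circ> chart_inv c)"
    using \<Phi> unfolding smooth_map_on_def by simp
  from this[rule_format, OF c' d]
  have "smooth_on (rep_dom c d) (chart_map d \<circ> (\<lambda>(t, p). \<Phi> t p) \<circ> chart_inv c')"
    by (simp only: set)
  then show ?thesis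
    by (rule smooth_on_cong[OF open_rep_dom[OF c d], rotated]) (auto simp: inv rep_dom_def rep_def)
qed

lemma isCont_\<Phi>:
  assumes "t \<in> I"
  shows "isCont (\<Phi> t) p" "isCont (\<lambda>t. \<Phi> t p) t"
proof -
  have 2: "continuous_on (I \<times> UNIV) (\<lambda>z. \<Phi> (fst z) (snd z))"
    using \<Phi> unfolding smooth_map_on_def by (simp add: case_prod_beta')
  have "continuous_on UNIV (\<Phi> t)"
    by (rule continuous_on_compose2[OF 2, of UNIV "\<lambda>p. (t, p)", simplified])
       (use assms in \<open>auto intro!: continuous_intros\<close>)
  then show "isCont (\<Phi> t) p" by (simp add: continuous_on_eq_continuous_at)
  have "continuous_on I (\<lambda>t. \<Phi> t p)"
    by (rule continuous_on_compose2[OF 2, of I "\<lambda>t. (t, p)", simplified])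
       (auto intro!: continuous_intros)
  then show "isCont (\<lambda>t. \<Phi> t p) t" using assms by (simp add: continuous_on_eq_continuous_at)
qed

lemma rep_has_derivative:
  "c \<in> A \<Longrightarrow> d \<in> B \<Longrightarrow> z \<in> rep_dom c d \<Longrightarrow> (rep c d has_derivative drep c d z) (at z)"
  using smooth_on_has_derivative[OF smooth_on_rep] .

lemma has_derivative_slice:
  fixes f :: "real \<times> 'e \<Rightarrow> 'b::real_normed_vector"
  assumes "(f has_derivative f') (at (t, x))"
  shows "((\<lambda>x. f (t, x)) has_derivative (\<lambda>h. f' (0, h))) (at x)"
    and "((\<lambda>t. f (t, x)) has_derivative (\<lambda>h. f' (h, 0))) (at t)"
    and "((\<lambda>t. f (t, x)) has_vector_derivative f' (1, 0)) (at t)"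
proof -
  have "((\<lambda>x. (t, x)) has_derivative (\<lambda>h. (0, h))) (at x)" "((\<lambda>t. (t, x)) has_derivative (\<lambda>h. (h, 0))) (at t)"
    by (auto intro!: derivative_eq_intros)
  from diff_chain_at[OF this(1) assms] diff_chain_at[OF this(2) assms]
  show 1: "((\<lambda>x. f (t, x)) has_derivative (\<lambda>h. f' (0, h))) (at x)"
    and 2: "((\<lambda>t. f (t, x)) has_derivative (\<lambda>h. f' (h, 0))) (at t)" by (auto simp: o_def)
  have "f' (h, 0) = h *\<^sub>R f' (1, 0)" for h
    using linear_scale[OF has_derivative_linear[OF assms], of h "(1, 0)"] by simp
  then have "(\<lambda>h. f' (h, 0)) = (\<lambda>h. h *\<^sub>R f' (1, 0))" by (rule ext)
  with 2 show "((\<lambda>t. f (t, x)) has_vector_derivative f' (1, 0)) (at t)"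
    by (simp only: has_vector_derivative_def)
qed

lemma tangent_map_\<Phi>:
  assumes t: "t \<in> I" and c: "c \<in> A" "p \<in> chart_dom c" and d: "d \<in> B" "\<Phi> t p \<in> chart_dom d"
  shows "tangent_map A B (\<Phi> t) p (from_coords A c p u) =
      from_coords B d (\<Phi> t p) (drep c d (t, chart_map c p) (0, u))"
    and "linear (tangent_map A B (\<Phi> t) p)"
proof -
  have "(rep c d has_derivative drep c d (t, chart_map c p)) (at (t, chart_map c p))"
    by (rule rep_has_derivative[OF c(1) d(1) rep_domI[OF t c(2,1) d(2)]])
  from has_derivative_slice(1)[OF this]
  have "(chart_map d \<circ> \<Phi> t \<circ> chart_inv c has_derivative (\<lambda>u. drep c d (t, chart_map c p) (0, u))) (at (chart_map c p))"
    by (simp add: rep_def o_def)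
  from tangent_map_coords[where f="\<Phi> t" and p=p and d=d, OF A B c d isCont_\<Phi>(1)[OF t, of p] this] show
    "tangent_map A B (\<Phi> t) p (from_coords A c p u) =
      from_coords B d (\<Phi> t p) (drep c d (t, chart_map c p) (0, u))"
    "linear (tangent_map A B (\<Phi> t) p)" .
qed

lemma velocity_\<Phi>:
  assumes t: "t \<in> I" and c: "c \<in> A" "p \<in> chart_dom c" and d: "d \<in> B" "\<Phi> t p \<in> chart_dom d"
  shows "velocity B (\<lambda>t. \<Phi> t p) t = from_coords B d (\<Phi> t p) (drep c d (t, chart_map c p) (1, 0))"
proof (rule velocity_coords[where \<gamma>="\<lambda>t. \<Phi> t p" and t=t and d=d and w="drep c d (t, chart_map c p) (1, 0)", OF B d isCont_\<Phi>(2)[OF t, of p]])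
  have "(rep c d has_derivative drep c d (t, chart_map c p)) (at (t, chart_map c p))"
    by (rule rep_has_derivative[OF c(1) d(1) rep_domI[OF t c(2,1) d(2)]])
  from has_derivative_slice(3)[OF this]
  show "((\<lambda>s. chart_map d (\<Phi> s p)) has_vector_derivative drep c d (t, chart_map c p) (1, 0)) (at t)"
    using chart_inv_map[OF smooth_atlasD(1)[OF A c(1)] c(2)] by (simp add: rep_def o_def)
qed

end

section \<open>Pullbacks, the 1-form \<open>iota\<close> and its exterior derivative\<close>

context variation
begin

lemma \<omega>_tensor: "smooth_tensor B 2 \<omega>"
  using \<omega> unfolding smooth_form_def by simp

lemma W_bilinear: "d \<in> B \<Longrightarrow> smooth_bilinear (chart_image d) (W d)"
  by (rule smooth_bilinear_tensor_coords[OF B _ \<omega>_tensor])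

lemma \<omega>_skew: "\<omega> q [u, v] = - \<omega> q [v, u]"
proof -
  have alt: "\<omega> q [w, w] = 0" for w
  proof -
    have "length vs = 2 \<and> i < j \<and> j < 2 \<and> vs ! i = vs ! j \<longrightarrow> \<omega> q vs = 0" for vs i j
      using \<omega> unfolding smooth_form_def by blast
    from this[of "[w, w]" 0 1] show ?thesis by simp
  qed
  \<comment> \<open>Polarization of \<open>alt\<close>.\<close>
  have "\<omega> q [u + v, u + v] = \<omega> q [u, u] + \<omega> q [u, v] + (\<omega> q [v, u] + \<omega> q [v, v])"
    using linear_add[OF smooth_tensor2_linear(1)[OF \<omega>_tensor], of q u v "u + v"]
      linear_add[OF smooth_tensor2_linear(2)[OF \<omega>_tensor], of q u u v]
      linear_add[OF smooth_tensor2_linear(2)[OF \<omega>_tensor], of q v u v] by simp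
  then show ?thesis by (simp add: alt)
qed

lemma W_skew: "W d y u v = - W d y v u"
  unfolding tensor_coords_def list.map by (rule \<omega>_skew)

lemma rep_image: "rep c d ` rep_dom c d \<subseteq> chart_image d"
  unfolding rep_def rep_dom_def by auto

lemma rep_domD:
  assumes "c \<in> A" "d \<in> B" "(t, x) \<in> rep_dom c d"
  shows "t \<in> I" "x \<in> chart_image c" "\<Phi> t (chart_inv c x) \<in> chart_dom d"
    "chart_inv d (rep c d (t, x)) = \<Phi> t (chart_inv c x)"
  using assms chart_inv_map[OF smooth_atlasD(1)[OF B assms(2)]] unfolding rep_dom_def rep_def by auto

lemma ex_rep_dom:
  assumes "t \<in> I" "x \<in> chart_image c"
  shows "\<exists>d\<in>B. (t, x) \<in> rep_dom c d"
  using assms chart_at[OF B, of "\<Phi> t (chart_inv c x)"] unfolding rep_dom_def by auto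

lemma pullback_coords:
  assumes c: "c \<in> A" and d: "d \<in> B" and z: "(t, x) \<in> rep_dom c d"
  shows "tensor_coords A c (pullback A B (\<Phi> t) \<omega>) x [u, v] =
     W d (rep c d (t, x)) (drep c d (t, x) (0, u)) (drep c d (t, x) (0, v))"
  using tangent_map_\<Phi>(1)[OF rep_domD(1)[OF c d z] c chart_inv_in_dom[OF rep_domD(2)[OF c d z]] d rep_domD(3)[OF c d z]]
    rep_domD(2,4)[OF c d z]
  by (simp add: tensor_coords_def pullback_def chart_map_inv)

definition iota :: "('m, 'e) tensor" where
  "iota p vs = \<omega> (\<Phi> 0 p) [velocity B (\<lambda>t. \<Phi> t p) 0, tangent_map A B (\<Phi> 0) p (vs ! 0)]"

text \<open>The same expression as for the pullback, with the time direction \<open>(1, 0)\<close>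
  in the first slot instead of \<open>(0, u)\<close>; a single derivative formula will cover
  both.\<close>

lemma iota_coords:
  assumes c: "c \<in> A" and d: "d \<in> B" and z: "(0, x) \<in> rep_dom c d"
  shows "tensor_coords A c iota x [v] =
     W d (rep c d (0, x)) (drep c d (0, x) (1, 0)) (drep c d (0, x) (0, v))"
  using tangent_map_\<Phi>(1)[OF rep_domD(1)[OF c d z] c chart_inv_in_dom[OF rep_domD(2)[OF c d z]] d rep_domD(3)[OF c d z]]
    velocity_\<Phi>[OF rep_domD(1)[OF c d z] c chart_inv_in_dom[OF rep_domD(2)[OF c d z]] d rep_domD(3)[OF c d z]]
    rep_domD(2,4)[OF c d z]
  by (simp add: tensor_coords_def iota_def chart_map_inv)

lemma smooth_on_W_drep:
  assumes c: "c \<in> A" and d: "d \<in> B"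
  shows "smooth_on (rep_dom c d) (\<lambda>z. W d (rep c d z) (drep c d z h) (drep c d z k))"
  by (rule smooth_bilinear.smooth_on_comp[OF W_bilinear[OF d] open_rep_dom[OF c d] rep_image smooth_on_rep[OF c d]
        smooth_on_frechet_derivative_const[OF smooth_on_rep[OF c d]]
        smooth_on_frechet_derivative_const[OF smooth_on_rep[OF c d]]])

text \<open>Joint smoothness in time and space is what later permits differentiation of the
  integral. One chart of \<open>N\<close> need not contain the image of a whole chart of
  \<open>M\<close>, so the claim is checked on the open sets \<open>rep_dom c d\<close>, which
  cover.\<close>

lemma smooth_on_pullback:
  assumes c: "c \<in> A"
  shows "smooth_on (I \<times> chart_image c) (\<lambda>z. tensor_coords A c (pullback A B (\<Phi> (fst z)) \<omega>) (snd z) [u, v])"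
proof (rule smooth_on_local)
  fix z assume z: "z \<in> I \<times> chart_image c"
  then obtain d where d: "d \<in> B" "z \<in> rep_dom c d" using ex_rep_dom[of "fst z" "snd z" c] by auto
  have "smooth_on (rep_dom c d) (\<lambda>z. tensor_coords A c (pullback A B (\<Phi> (fst z)) \<omega>) (snd z) [u, v])"
    by (rule smooth_on_cong[OF open_rep_dom[OF c d(1)] _ smooth_on_W_drep[OF c d(1), of "(0, u)" "(0, v)"]])
       (use pullback_coords[OF c d(1)] in force)
  then show "\<exists>U. open U \<and> z \<in> U \<and> smooth_on U (\<lambda>z. tensor_coords A c (pullback A B (\<Phi> (fst z)) \<omega>) (snd z) [u, v])"
    using open_rep_dom[OF c d(1)] d(2) by blast
qed

lemma smooth_on_slice:
  fixes f :: "real \<times> 'e \<Rightarrow> 'b::real_normed_vector"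
  assumes "open S" "smooth_on S f" "open T" "\<And>x. x \<in> T \<Longrightarrow> (t, x) \<in> S"
  shows "smooth_on T (\<lambda>x. f (t, x))"
  by (rule smooth_on_compose[OF assms(3,1) _ assms(2) smooth_on_Pair[OF assms(3) smooth_on_const smooth_on_id]])
     (use assms(4) in auto)

lemma linear_tangent_map: "t \<in> I \<Longrightarrow> linear (tangent_map A B (\<Phi> t) p)"
  by (rule tangent_map_\<Phi>(2)[OF _ chart_at[OF A] chart_at[OF B]])

lemma smooth_form_pullback:
  assumes t: "t \<in> I"
  shows "smooth_form A 2 (pullback A B (\<Phi> t) \<omega>)"
  unfolding smooth_form_def smooth_tensor_def
proof (intro conjI allI ballI impI; (elim conjE)?)
  fix p vs and i :: nat assume vs: "length (vs :: 'e list) = 2" "i < 2"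
  have "linear (\<lambda>w. \<omega> (\<Phi> t p) ((map (tangent_map A B (\<Phi> t) p) vs)[i := w]))"
    using \<omega>_tensor vs unfolding smooth_tensor_def by simp
  from linear_compose[OF linear_tangent_map[OF t, of p] this]
  show "linear (\<lambda>u. pullback A B (\<Phi> t) \<omega> p (vs[i := u]))"
    by (simp add: pullback_def map_update o_def)
next
  fix c vs assume c: "c \<in> A" and "length (vs :: 'e list) = 2"
  then obtain u v where vs: "vs = [u, v]" by (auto simp: list_length_2)
  show "smooth_on (chart_image c) (\<lambda>x. tensor_coords A c (pullback A B (\<Phi> t) \<omega>) x vs)"
    using smooth_on_slice[OF _ smooth_on_pullback[OF c, of u v], of "chart_image c" t] t
      open_chart_image[OF smooth_atlasD(1)[OF A c]] by (simp add: vs open_Times)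
next
  fix p vs and i j :: nat assume vs: "length (vs :: 'e list) = 2" "i < j" "j < 2" "vs ! i = vs ! j"
  have "length ws = 2 \<and> i < j \<and> j < 2 \<and> ws ! i = ws ! j \<longrightarrow> \<omega> q ws = 0" for ws q
    using \<omega> unfolding smooth_form_def by blast
  then show "pullback A B (\<Phi> t) \<omega> p vs = 0"
    unfolding pullback_def using vs by auto
qed

lemma smooth_on_iota:
  assumes c: "c \<in> A"
  shows "smooth_on (chart_image c) (\<lambda>x. tensor_coords A c iota x [v])"
proof (rule smooth_on_local)
  fix x assume x: "x \<in> chart_image c"
  then obtain d where d: "d \<in> B" "(0, x) \<in> rep_dom c d" using ex_rep_dom[of 0 x c] \<epsilon> by auto
  let ?U = "Pair 0 -` rep_dom c d"
  have U: "open ?U" by (rule open_vimage[OF open_rep_dom[OF c d(1)]]) (intro continuous_intros)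
  have "smooth_on ?U (\<lambda>x. tensor_coords A c iota x [v])"
    by (rule smooth_on_cong[OF U _ smooth_on_slice[OF open_rep_dom[OF c d(1)]
            smooth_on_W_drep[OF c d(1), of "(1, 0)" "(0, v)"] U, of 0]])
       (use iota_coords[OF c d(1)] in auto)
  then show "\<exists>U. open U \<and> x \<in> U \<and> smooth_on U (\<lambda>x. tensor_coords A c iota x [v])"
    using U d(2) by blast
qed

lemma smooth_form_iota: "smooth_form A 1 iota"
  unfolding smooth_form_def smooth_tensor_def
proof (intro conjI allI ballI impI; (elim conjE)?)
  fix p vs and i :: nat assume vs: "length (vs :: 'e list) = 1" "i < 1"
  from linear_compose[OF linear_tangent_map[of 0] smooth_tensor2_linear(2)[OF \<omega>_tensor]]
  show "linear (\<lambda>u. iota p (vs[i := u]))"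
    using vs \<epsilon> by (simp add: iota_def o_def)
next
  fix c vs assume c: "c \<in> A" and "length (vs :: 'e list) = 1"
  then show "smooth_on (chart_image c) (\<lambda>x. tensor_coords A c iota x vs)"
    using smooth_on_iota[OF c] by (auto simp: list_length_1)
qed simp

text \<open>Cartan's formula for the closed form \<open>\<omega>\<close>: the terms containing second derivatives of the
  variation cancel because partial derivatives commute.\<close>

lemma pullback_has_derivative:
  assumes closed: "\<And>q u v w. ext_deriv B \<omega> q [u, v, w] = 0"
  shows "((\<lambda>t. pullback A B (\<Phi> t) \<omega> p [u, v]) has_real_derivative ext_deriv A iota p [u, v]) (at 0)"
proof -
  \<comment> \<open>In these two charts the exterior derivatives at \<open>p\<close> and at
    \<open>\<Phi> 0 p\<close> are defined, so \<open>ext\<close> and \<open>cl\<close> below unfold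
    without a change of coordinates.\<close>
  define c where "c = chart_at A p"
  define d where "d = chart_at B (\<Phi> 0 p)"
  have c: "c \<in> A" "p \<in> chart_dom c" and d: "d \<in> B" "\<Phi> 0 p \<in> chart_dom d"
    using chart_at[OF A] chart_at[OF B] by (auto simp: c_def d_def)
  note invp = chart_inv_map[OF smooth_atlasD(1)[OF A c(1)] c(2)]
  define x where "x = chart_map c p"
  have z: "(0, x) \<in> rep_dom c d" using rep_domI[OF _ c(2,1) d(2)] \<epsilon> by (simp add: x_def)
  note opn = open_rep_dom[OF c(1) d(1)]
  interpret W: smooth_bilinear "chart_image d" "W d" by (rule W_bilinear[OF d(1)])
  define f where "f = rep c d (0, x)"
  have f: "f = chart_map d (\<Phi> 0 p)" by (simp add: f_def rep_def x_def invp)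
  have f_in: "f \<in> chart_image d" using f d by simp
  define D where "D h = drep c d (0, x) h" for h
  define D2 where "D2 k h = frechet_derivative (\<lambda>z. drep c d z k) (at (0, x)) h" for k h
  have D2_sym: "D2 k h = D2 h k" for h k
    unfolding D2_def by (rule frechet_derivative_commute[OF opn z smooth_on_rep[OF c(1) d(1)]])
  \<comment> \<open>Used twice: with \<open>(1, 0)\<close> and \<open>(0, v)\<close>, differentiated
    in space, for \<open>iota\<close>; with \<open>(0, u)\<close> and \<open>(0, v)\<close>,
    differentiated in time, for the pullback.\<close>
  have der: "((\<lambda>z. W d (rep c d z) (drep c d z h) (drep c d z k)) has_derivative
     (\<lambda>l. W.WD f (D l) (D h) (D k) + W d f (D2 h l) (D k) + W d f (D h) (D2 k l))) (at (0, x))" for h k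
    unfolding f_def D_def D2_def
    by (rule W.has_derivative_comp[OF opn rep_image z rep_has_derivative[OF c(1) d(1) z]
          smooth_on_has_derivative[OF smooth_on_frechet_derivative_const[OF smooth_on_rep[OF c(1) d(1)]] z]
          smooth_on_has_derivative[OF smooth_on_frechet_derivative_const[OF smooth_on_rep[OF c(1) d(1)]] z]])
  have der_iota: "frechet_derivative (\<lambda>x. tensor_coords A c iota x [v]) (at x) u =
     W.WD f (D (0, u)) (D (1, 0)) (D (0, v)) + W d f (D2 (1, 0) (0, u)) (D (0, v)) + W d f (D (1, 0)) (D2 (0, v) (0, u))" for u v
  proof (rule frechet_derivative_eq)
    let ?U = "Pair 0 -` rep_dom c d"
    have U: "open ?U" by (rule open_vimage[OF opn]) (intro continuous_intros)
    show "((\<lambda>x. tensor_coords A c iota x [v]) has_derivative (\<lambda>u. W.WD f (D (0, u)) (D (1, 0)) (D (0, v))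
        + W d f (D2 (1, 0) (0, u)) (D (0, v)) + W d f (D (1, 0)) (D2 (0, v) (0, u)))) (at x)"
      by (rule has_derivative_transform_within_open[OF has_derivative_slice(1)[OF der[of "(1, 0)" "(0, v)"]] U])
         (use z iota_coords[OF c(1) d(1)] in auto)
  qed
  have ext: "ext_deriv A iota p [u, v] = frechet_derivative (\<lambda>x. tensor_coords A c iota x [v]) (at x) u
     - frechet_derivative (\<lambda>x. tensor_coords A c iota x [u]) (at x) v"
    by (simp add: ext_deriv_def c_def[symmetric] x_def[symmetric] numeral_2_eq_2 lessThan_Suc)
  have "ext_deriv B \<omega> (\<Phi> 0 p) [a, b, e] = W.WD f a b e - W.WD f b a e + W.WD f e a b" for a b e
    by (simp add: ext_deriv_def d_def[symmetric] f[symmetric] W.WD_def numeral_3_eq_3 lessThan_Suc)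
  \<comment> \<open>Closedness solved for the term differentiated in direction \<open>a\<close>,
    which will be the variation field \<open>D (1, 0)\<close>.\<close>
  then have cl: "W.WD f a b e = W.WD f b a e - W.WD f e a b" for a b e
    using closed[of "\<Phi> 0 p" a b e] by simp
  let ?V = "{t. (t, x) \<in> rep_dom c d}"
  have V: "open ?V" using open_vimage[OF opn, of "\<lambda>t. (t, x)"] by (simp add: vimage_def continuous_intros)
  have fcp: "from_coords A c p u = u" for u
    unfolding c_def by (rule from_coords_chart_at[OF A])
  have pb: "pullback A B (\<Phi> t) \<omega> p [u, v] =
    W d (rep c d (t, x)) (drep c d (t, x) (0, u)) (drep c d (t, x) (0, v))" if "t \<in> ?V" for t
    using pullback_coords[OF c(1) d(1), of t x u v] that by (simp add: tensor_coords_def x_def invp fcp)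
  have "((\<lambda>t. pullback A B (\<Phi> t) \<omega> p [u, v]) has_vector_derivative
    W.WD f (D (1, 0)) (D (0, u)) (D (0, v)) + W d f (D2 (0, u) (1, 0)) (D (0, v)) + W d f (D (0, u)) (D2 (0, v) (1, 0))) (at 0)"
    by (rule has_vector_derivative_transform_within_open[OF has_derivative_slice(3)[OF der[of "(0, u)" "(0, v)"]] V])
       (use z pb in auto)
  \<comment> \<open>Second derivatives mixed in time and space agree on both sides, one pair after a
    sign from \<open>W_skew\<close>; the purely spatial ones cancel within the exterior
    derivative.\<close>
  moreover have "W.WD f (D (1, 0)) (D (0, u)) (D (0, v)) + W d f (D2 (0, u) (1, 0)) (D (0, v)) + W d f (D (0, u)) (D2 (0, v) (1, 0))
    = ext_deriv A iota p [u, v]"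
    unfolding ext der_iota cl[of "D (1, 0)"] D2_sym[of "(0, u)" "(1, 0)"] D2_sym[of "(0, v)" "(1, 0)"]
      D2_sym[of "(0, u)" "(0, v)"] W_skew[of d f "D (0, u)"]
    by simp
  ultimately show ?thesis by (simp add: has_real_derivative_iff_has_vector_derivative)
qed

end

section \<open>The Kaehler form\<close>

lemma smooth_tensor2I:
  fixes B :: "('n, 'f::euclidean_space) chart set"
  assumes "\<And>q v. linear (\<lambda>u. \<omega> q [u, v])" "\<And>q u. linear (\<lambda>v. \<omega> q [u, v])"
    and "\<And>c u v. c \<in> B \<Longrightarrow> smooth_on (chart_image c) (\<lambda>x. tensor_coords B c \<omega> x [u, v])"
  shows "smooth_tensor B 2 \<omega>"
  unfolding smooth_tensor_def
proof (intro conjI allI ballI impI; (elim conjE)?)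
  fix p and vs :: "'f list" and i :: nat assume vs: "length vs = 2" "i < 2"
  obtain u v where uv: "vs = [u, v]" using vs(1)[unfolded list_length_2] by blast
  consider "i = 0" | "i = Suc 0" using vs(2) by linarith
  then show "linear (\<lambda>u. \<omega> p (vs[i := u]))"
    by cases (simp_all add: uv assms(1,2))
next
  fix c and vs :: "'f list" assume "c \<in> B" "length vs = 2"
  then show "smooth_on (chart_image c) (\<lambda>x. tensor_coords B c \<omega> x vs)"
    unfolding list_length_2 using assms(3) by blast
qed

lemma smooth_form2I:
  fixes B :: "('n, 'f::euclidean_space) chart set"
  assumes "smooth_tensor B 2 \<omega>" "\<And>q u. \<omega> q [u, u] = 0"
  shows "smooth_form B 2 \<omega>"
  unfolding smooth_form_def
proof (intro conjI allI impI assms(1); elim conjE)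
  fix p and vs :: "'f list" and i j :: nat
  assume vs: "length vs = 2" "i < j" "j < 2" "vs ! i = vs ! j"
  then have "i = 0" "j = 1" by auto
  moreover obtain u v where "vs = [u, v]" using vs(1)[unfolded list_length_2] by blast
  ultimately show "\<omega> p vs = 0" using vs(4) assms(2) by simp
qed

text \<open>Matrix of \<open>J\<close> in an atlas chart, where it may vary from point to point; the
  charts with constant \<open>J\<close> need only be compatible with the atlas.\<close>

definition J_coords :: "('n, 'f::euclidean_space) chart set \<Rightarrow> ('n \<Rightarrow> 'f \<Rightarrow> 'f) \<Rightarrow> ('n, 'f) chart \<Rightarrow> 'f \<Rightarrow> 'f \<Rightarrow> 'f" where
  "J_coords B J d y u = to_coords B d (chart_inv d y) (J (chart_inv d y) (from_coords B d (chart_inv d y) u))"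

context
  fixes B :: "('n::{t2_space,second_countable_topology}, 'f::euclidean_space) chart set"
    and J :: "'n \<Rightarrow> 'f \<Rightarrow> 'f"
  assumes B: "smooth_atlas B" and J: "complex_structure B J"
begin

text \<open>Near a given point \<open>J\<close> is a constant \<open>K\<close> in some compatible
  chart \<open>c\<close>. On the overlap with \<open>d\<close> it is therefore \<open>K\<close>
  conjugated by the Jacobian of a coordinate change, which is smooth.\<close>

lemma smooth_on_J_coords:
  assumes d: "d \<in> B"
  shows "smooth_on (chart_image d) (\<lambda>y. J_coords B J d y u)"
proof (rule smooth_on_local)
  fix y0 assume y0: "y0 \<in> chart_image d"
  define q0 where "q0 = chart_inv d y0"
  obtain c K where c: "smooth_chart B c" "q0 \<in> chart_dom c"
    and K: "\<And>q v. q \<in> chart_dom c \<Longrightarrow> to_coords B c q (J q v) = K (to_coords B c q v)"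
    using J unfolding complex_structure_def by metis
  have Jlin: "linear (J q)" for q using J unfolding complex_structure_def by blast
  note sd = smooth_chartI[OF B d]
  have ch: "is_chart c" "is_chart d" using smooth_atlasD(1)[OF B d] c(1) unfolding smooth_chart_def by auto
  have comp: "compatible c d" using c(1) d unfolding smooth_chart_def by blast
  note comp' = compatible_sym[OF comp]
  \<comment> \<open>Linearity of \<open>K\<close> is recovered from that of \<open>J\<close> at the
    single point \<open>q0\<close>.\<close>
  have "K = to_coords B c q0 \<circ> J q0 \<circ> from_coords B c q0"
    using K[OF c(2)] to_from_coords[OF B c] by (auto simp: fun_eq_iff)
  then have "linear K"
    using linear_compose[OF linear_compose[OF linear_from_coords[OF B c] Jlin] linear_to_coords[OF B c]]
    by (simp add: o_assoc)
  then have bK: "bounded_linear K" by (simp add: linear_conv_bounded_linear)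
  let ?U = "chart_map d ` (chart_dom d \<inter> chart_dom c)" and ?V = "chart_map c ` (chart_dom c \<inter> chart_dom d)"
  have U: "open ?U" and V: "open ?V" using ch by (auto intro!: open_chart_map_image open_chart_dom)
  have tr: "smooth_on ?U (transition d c)" and tr': "smooth_on ?V (transition c d)"
    using smooth_on_transition[OF comp'] smooth_on_transition[OF comp] by auto
  have im: "transition d c ` ?U \<subseteq> ?V" using ch by (auto simp: transition_chart_map)
  have eq: "J_coords B J d y u = frechet_derivative (transition c d) (at (transition d c y))
      (K (frechet_derivative (transition d c) (at y) u))" if y: "y \<in> ?U" for y
  proof -
    obtain q where q: "q \<in> chart_dom d" "q \<in> chart_dom c" "y = chart_map d q" using y by blast
    have "J q w = from_coords B c q (K (to_coords B c q w))" for w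
      using from_to_coords[OF B c(1) q(2)] K[OF q(2)] by metis
    then have "J_coords B J d y u = to_coords B d q (from_coords B c q (K (to_coords B c q (from_coords B d q u))))"
      by (simp add: J_coords_def q chart_inv_map ch)
    also have "\<dots> = dtrans c d q (K (dtrans d c q u))"
      using to_coords_from_coords[OF B c(1) sd comp q(2,1)] to_coords_from_coords[OF B sd c(1) comp' q(1,2)] by simp
    finally show ?thesis by (simp add: dtrans_def q transition_chart_map ch)
  qed
  have "smooth_on ?U (\<lambda>y. frechet_derivative (transition c d) (at (transition d c y))
      (K (frechet_derivative (transition d c) (at y) u)))"
  proof (rule smooth_on_linear_family[OF U, where L="\<lambda>y. frechet_derivative (transition c d) (at (transition d c y))"])
    show "linear (frechet_derivative (transition c d) (at (transition d c y)))" if "y \<in> ?U" for y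
      by (rule linear_frechet_derivative[OF smooth_on_imp_differentiable[OF tr']]) (use im that in blast)
    show "smooth_on ?U (\<lambda>y. frechet_derivative (transition c d) (at (transition d c y)) b)" for b
      by (rule smooth_on_compose[OF U V im smooth_on_frechet_derivative_const[OF tr'] tr])
    show "smooth_on ?U (\<lambda>y. K (frechet_derivative (transition d c) (at y) u))"
      by (rule smooth_on_bounded_linear[OF bK U smooth_on_frechet_derivative_const[OF tr]])
  qed
  then have "smooth_on ?U (\<lambda>y. J_coords B J d y u)"
    by (rule smooth_on_cong[OF U, rotated]) (rule eq[symmetric])
  moreover have "y0 \<in> ?U"
    using c(2) chart_inv_in_dom[OF y0] chart_map_inv[OF y0] unfolding q0_def
    by (intro image_eqI[of _ _ "chart_inv d y0"]) auto
  ultimately show "\<exists>U. open U \<and> y0 \<in> U \<and> smooth_on U (\<lambda>y. J_coords B J d y u)" using U by blast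
qed

lemma smooth_form_kaehler_form:
  assumes h: "riemannian_metric B h" and hJ: "\<And>q u v. h q [J q u, J q v] = h q [u, v]"
  shows "smooth_form B 2 (kaehler_form h J)"
proof (rule smooth_form2I[OF smooth_tensor2I])
  have ht: "smooth_tensor B 2 h" and sym: "\<And>q u v. h q [u, v] = h q [v, u]"
    using h unfolding riemannian_metric_def by auto
  have Jlin: "linear (J q)" and JJ: "J q (J q v) = - v" for q v
    using J unfolding complex_structure_def by auto
  show "linear (\<lambda>u. kaehler_form h J q [u, v])" for q v
    using linear_compose[OF Jlin smooth_tensor2_linear(1)[OF ht]] by (simp add: kaehler_form_def o_def)
  show "linear (\<lambda>v. kaehler_form h J q [u, v])" for q u
    using smooth_tensor2_linear(2)[OF ht] by (simp add: kaehler_form_def)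
  show "kaehler_form h J q [u, u] = 0" for q u
  proof -
    \<comment> \<open>Invariance of the metric applied to the pair \<open>J q u\<close>,
      \<open>u\<close>: since \<open>J\<close> squares to -1 and \<open>h\<close> is symmetric, the
      value turns into its own negative.\<close>
    have "h q [J q u, u] = h q [J q (J q u), J q u]" by (rule hJ[symmetric])
    also have "\<dots> = - h q [u, J q u]"
      unfolding JJ using linear_neg[OF smooth_tensor2_linear(1)[OF ht]] by blast
    finally show ?thesis using sym[of q u "J q u"] by (simp add: kaehler_form_def)
  qed
  fix d u v assume d: "d \<in> B"
  have op: "open (chart_image d)" using open_chart_image smooth_atlasD(1)[OF B d] by blast
  have "smooth_on (chart_image d) (\<lambda>y. tensor_coords B d h y [J_coords B J d y u, v])"
    by (rule smooth_bilinear.smooth_on_comp[OF smooth_bilinear_tensor_coords[OF B d ht] op _ smooth_on_id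
          smooth_on_J_coords[OF d] smooth_on_const]) simp
  then show "smooth_on (chart_image d) (\<lambda>y. tensor_coords B d (kaehler_form h J) y [u, v])"
    by (rule smooth_on_cong[OF op, rotated])
       (simp add: tensor_coords_def kaehler_form_def J_coords_def
          from_to_coords[OF B smooth_chartI[OF B d] chart_inv_in_dom])
qed

end

section \<open>Riemannian metrics in coordinates\<close>

context
  fixes A :: "('m, 'e::euclidean_space) chart set" and g :: "('m, 'e) tensor"
  assumes g: "riemannian_metric A g"
begin

lemma metric_linear:
  "linear (\<lambda>u. g p [u, v])" "linear (\<lambda>v. g p [u, v])"
  by (rule smooth_tensor2_linear[OF conjunct1[OF g[unfolded riemannian_metric_def]]])+

lemma metric_sym: "g p [u, v] = g p [v, u]"
  using g unfolding riemannian_metric_def by blast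

lemma metric_pos: "u \<noteq> 0 \<Longrightarrow> g p [u, u] > 0"
  using g unfolding riemannian_metric_def by blast

lemma metric_orthonormal_sum:
  assumes "finite b" "\<And>u v. u \<in> b \<Longrightarrow> v \<in> b \<Longrightarrow> g p [u, v] = (if u = v then 1 else 0)" "e \<in> b"
  shows "g p [\<Sum>u\<in>b. c u *\<^sub>R u, e] = c e"
proof -
  have "g p [\<Sum>u\<in>b. c u *\<^sub>R u, e] = (\<Sum>u\<in>b. c u * g p [u, e])"
    by (simp add: linear_sum[OF metric_linear(1)] linear_scale[OF metric_linear(1)])
  also have "\<dots> = (\<Sum>u\<in>b. if u = e then c u else 0)"
    by (rule sum.cong) (use assms in auto)
  finally show ?thesis using assms by simp
qed

lemma orthonormal_imp_independent:
  assumes "finite b" "\<And>u v. u \<in> b \<Longrightarrow> v \<in> b \<Longrightarrow> g p [u, v] = (if u = v then 1 else 0)"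
  shows "independent b"
  unfolding independent_explicit
proof (intro conjI allI impI ballI assms(1))
  fix c e assume c: "(\<Sum>v\<in>b. c v *\<^sub>R v) = 0" and e: "e \<in> b"
  have "g p [\<Sum>v\<in>b. c v *\<^sub>R v, e] = c e"
    by (rule metric_orthonormal_sum[OF assms(1) _ e]) (rule assms(2))
  then show "c e = 0" unfolding c using linear_0[OF metric_linear(1)] by simp
qed

text \<open>\<open>form_inner\<close> takes its basis by choice, which means something only once a
  basis exists. An orthonormal family of largest cardinality spans: a vector outside the span would
  give one more member by a Gram-Schmidt step.\<close>

lemma ex_orthonormal_basis: "\<exists>b. orthonormal_basis g p b"
proof -
  define P where "P n \<longleftrightarrow> (\<exists>b. finite b \<and> card b = n \<and>
    (\<forall>u\<in>b. \<forall>v\<in>b. g p [u, v] = (if u = v then 1 else 0)))" for n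
  have "P 0" unfolding P_def by (intro exI[of _ "{}"]) auto
  moreover have bound: "n \<le> DIM('e)" if "P n" for n
    using that independent_bound orthonormal_imp_independent unfolding P_def by metis
  ultimately obtain n where n: "P n" and max: "\<And>m. P m \<Longrightarrow> m \<le> n"
    using Nat.ex_has_greatest_nat[of P 0 "DIM('e)"] by blast
  obtain b where b: "finite b" "card b = n" "\<And>u v. u \<in> b \<Longrightarrow> v \<in> b \<Longrightarrow> g p [u, v] = (if u = v then 1 else 0)"
    using n unfolding P_def by blast
  have "span b = UNIV"
  proof (rule ccontr)
    assume "span b \<noteq> UNIV"
    then obtain w where w: "w \<notin> span b" by blast
    define w' where "w' = w - (\<Sum>u\<in>b. g p [w, u] *\<^sub>R u)"
    have "(\<Sum>u\<in>b. g p [w, u] *\<^sub>R u) \<in> span b" by (intro span_sum span_scale span_base)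
    then have w': "w' \<notin> span b" using w span_add[of w' b "\<Sum>u\<in>b. g p [w, u] *\<^sub>R u"] unfolding w'_def by auto
    then have "w' \<noteq> 0" using span_zero by metis
    then have pos: "g p [w', w'] > 0" by (rule metric_pos)
    have orth: "g p [w', e] = 0" if "e \<in> b" for e
      unfolding w'_def using metric_orthonormal_sum[OF b(1,3) that, of "\<lambda>u. g p [w, u]"]
      by (simp add: linear_diff[OF metric_linear(1)])
    define r where "r = 1 / sqrt (g p [w', w'])"
    define e where "e = r *\<^sub>R w'"
    have r0: "r \<noteq> 0" using pos by (simp add: r_def)
    have "e \<notin> span b"
    proof
      assume "e \<in> span b"
      then have "(1 / r) *\<^sub>R e \<in> span b" by (rule span_scale)
      then show False using w' r0 by (simp add: e_def)
    qed
    then have "e \<notin> b" using span_base by blast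
    have ee: "g p [e, e] = 1"
      using pos by (simp add: e_def r_def linear_scale[OF metric_linear(1)] linear_scale[OF metric_linear(2)]
          real_sqrt_mult[symmetric] divide_simps)
    have eu: "g p [e, u] = 0" "g p [u, e] = 0" if "u \<in> b" for u
      using orth[OF that] metric_sym[of p u e] by (auto simp: e_def linear_scale[OF metric_linear(1)])
    have "\<forall>u\<in>insert e b. \<forall>v\<in>insert e b. g p [u, v] = (if u = v then 1 else 0)"
      using b(3) ee eu \<open>e \<notin> b\<close> by auto
    then have "P (Suc n)" unfolding P_def
      using b(1,2) \<open>e \<notin> b\<close> by (intro exI[of _ "insert e b"]) auto
    then show False using max[of "Suc n"] by simp
  qed
  then have "card b = DIM('e)"
    using indep_card_eq_dim_span[OF orthonormal_imp_independent[OF b(1,3)]] by (simp add: dim_UNIV)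
  then show ?thesis unfolding orthonormal_basis_def using b by blast
qed

text \<open>The difference of both sides is orthogonal to \<open>b\<close>, hence to the span of
  \<open>b\<close>, which is everything, hence to itself.\<close>

lemma orthonormal_basis_expand:
  assumes "orthonormal_basis g p b"
  shows "v = (\<Sum>e\<in>b. g p [v, e] *\<^sub>R e)"
proof (rule ccontr)
  assume ne: "v \<noteq> (\<Sum>e\<in>b. g p [v, e] *\<^sub>R e)"
  define w where "w = v - (\<Sum>e\<in>b. g p [v, e] *\<^sub>R e)"
  have b: "finite b" "card b = DIM('e)" "\<And>u v. u \<in> b \<Longrightarrow> v \<in> b \<Longrightarrow> g p [u, v] = (if u = v then 1 else 0)"
    using assms unfolding orthonormal_basis_def by auto
  have orth: "g p [w, e] = 0" if "e \<in> b" for e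
    unfolding w_def using metric_orthonormal_sum[OF b(1,3) that, of "\<lambda>u. g p [v, u]"]
    by (simp add: linear_diff[OF metric_linear(1)])
  have "UNIV \<subseteq> span b"
    using card_eq_dim[of b UNIV] b orthonormal_imp_independent[OF b(1,3)] by (simp add: dim_UNIV)
  then have "w \<in> span b" by auto
  then have "g p [w, w] = 0"
    by (rule linear_eq_0_on_span[OF metric_linear(2), rotated]) (rule orth)
  then show False using metric_pos[of w p] ne by (simp add: w_def)
qed

text \<open>The basis precedes the forms in the quantifiers because its choice depends on the metric
  and the point only. The divisor is \<open>fact 2\<close>.\<close>

lemma form_inner_2_eq:
  "\<exists>b. orthonormal_basis g p b \<and> (\<forall>\<alpha> \<beta>. form_inner g 2 \<alpha> \<beta> p =
     (\<Sum>e\<in>b. \<Sum>e'\<in>b. \<alpha> p [e, e'] * \<beta> p [e, e']) / 2)"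
proof -
  define b where "b = (SOME b. orthonormal_basis g p b)"
  have b: "orthonormal_basis g p b" unfolding b_def by (rule someI_ex[OF ex_orthonormal_basis])
  have "bij_betw (\<lambda>(e, e'). [e, e']) (b \<times> b) {es. length es = 2 \<and> set es \<subseteq> b}"
    by (rule bij_betwI[where g="\<lambda>es. (es ! 0, es ! 1)"]) (auto simp: list_length_2)
  note bij = sum.reindex_bij_betw[OF this]
  have "form_inner g 2 \<alpha> \<beta> p = (\<Sum>e\<in>b. \<Sum>e'\<in>b. \<alpha> p [e, e'] * \<beta> p [e, e']) / 2" for \<alpha> \<beta>
    using bij[of "\<lambda>es. \<alpha> p es * \<beta> p es"] unfolding form_inner_def Let_def b_def[symmetric]
    by (simp add: sum.cartesian_product case_prod_beta')
  then show ?thesis using b by blast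
qed

lemma form_inner_1_eq:
  "\<exists>b. orthonormal_basis g p b \<and> (\<forall>\<alpha> \<beta>. form_inner g 1 \<alpha> \<beta> p = (\<Sum>e\<in>b. \<alpha> p [e] * \<beta> p [e]))"
proof -
  define b where "b = (SOME b. orthonormal_basis g p b)"
  have b: "orthonormal_basis g p b" unfolding b_def by (rule someI_ex[OF ex_orthonormal_basis])
  have "bij_betw (\<lambda>e. [e]) b {es. length es = Suc 0 \<and> set es \<subseteq> b}"
    by (rule bij_betwI[where g="\<lambda>es. es ! 0"]) (auto simp: list_length_1)
  note bij = sum.reindex_bij_betw[OF this]
  have "form_inner g 1 \<alpha> \<beta> p = (\<Sum>e\<in>b. \<alpha> p [e] * \<beta> p [e])" for \<alpha> \<beta>
    using bij[of "\<lambda>es. \<alpha> p es * \<beta> p es"] unfolding form_inner_def Let_def b_def[symmetric] by simp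
  then show ?thesis using b by blast
qed

text \<open>The sum represents \<eta>, and a representing vector is determined by its products with
  \<open>b\<close>: existence and uniqueness for the description in \<open>sharp\<close>.\<close>

lemma sharp_eq:
  assumes b: "orthonormal_basis g p b" and \<eta>: "linear (\<lambda>v. \<eta> p [v])"
  shows "sharp g \<eta> p = (\<Sum>e\<in>b. \<eta> p [e] *\<^sub>R e)"
  unfolding sharp_def
proof (rule the_equality)
  show "\<forall>v. g p [\<Sum>e\<in>b. \<eta> p [e] *\<^sub>R e, v] = \<eta> p [v]"
  proof
    fix v
    have "\<eta> p [v] = \<eta> p [\<Sum>e\<in>b. g p [v, e] *\<^sub>R e]" using orthonormal_basis_expand[OF b, of v] by simp
    also have "\<dots> = (\<Sum>e\<in>b. g p [v, e] * \<eta> p [e])"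
      by (simp add: linear_sum[OF \<eta>] linear_scale[OF \<eta>])
    also have "\<dots> = g p [\<Sum>e\<in>b. \<eta> p [e] *\<^sub>R e, v]"
      by (simp add: linear_sum[OF metric_linear(1)] linear_scale[OF metric_linear(1)] metric_sym[of p v] mult.commute)
    finally show "g p [\<Sum>e\<in>b. \<eta> p [e] *\<^sub>R e, v] = \<eta> p [v]" by simp
  qed
  fix u assume u: "\<forall>v. g p [u, v] = \<eta> p [v]"
  have "u = (\<Sum>e\<in>b. g p [u, e] *\<^sub>R e)" by (rule orthonormal_basis_expand[OF b])
  then show "u = (\<Sum>e\<in>b. \<eta> p [e] *\<^sub>R e)" using u by simp
qed

text \<open>This turns the right side of the adjoint relation, an inner product of 1-forms, into the
  evaluation of \<iota> on a vector.\<close>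

lemma form_inner_1_sharp:
  assumes "linear (\<lambda>v. \<alpha> p [v])" "linear (\<lambda>v. \<eta> p [v])"
  shows "form_inner g 1 \<alpha> \<eta> p = \<alpha> p [sharp g \<eta> p]"
proof -
  obtain b where b: "orthonormal_basis g p b" "\<forall>\<alpha> \<beta>. form_inner g 1 \<alpha> \<beta> p = (\<Sum>e\<in>b. \<alpha> p [e] * \<beta> p [e])"
    using form_inner_1_eq by blast
  then show ?thesis
    by (simp add: sharp_eq[where \<eta>=\<eta>, OF b(1) assms(2)] linear_sum[OF assms(1)] linear_scale[OF assms(1)] mult.commute)
qed

end

section \<open>Inverse Gram matrix and inner products in a coordinate frame\<close>

lemma linear_vec_expand:
  fixes L :: "real^'k \<Rightarrow> 'b::real_vector"
  assumes "linear L"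
  shows "L v = (\<Sum>i\<in>UNIV. v $ i *\<^sub>R L (axis i 1))"
proof -
  have "L v = L (\<Sum>i\<in>UNIV. v $ i *\<^sub>R axis i 1)"
    using basis_expansion[of v] by (simp add: scalar_mult_eq_scaleR)
  then show ?thesis by (simp add: linear_sum[OF assms] linear_scale[OF assms])
qed

text \<open>The entries of the inverse matrix by Cramer's rule, which exhibits their continuity.\<close>

definition cramer_inv :: "real^'k^'k \<Rightarrow> 'k::finite \<Rightarrow> 'k \<Rightarrow> real" where
  "cramer_inv M k j = det (\<chi> i l. if l = k then axis j 1 $ i else M $ i $ l) / det M"

text \<open>Column \<open>j\<close> of a right inverse solves the linear system with right side
  \<open>axis j 1\<close>, and Cramer's rule gives its only solution.\<close>

lemma cramer_inv_eq:
  fixes M H :: "real^'k^'k"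
  assumes "M ** H = mat 1"
  shows "det M \<noteq> 0" "H $ k $ j = cramer_inv M k j"
proof -
  show d: "det M \<noteq> 0" using assms by (metis det_I det_mul mult_zero_left zero_neq_one)
  have "M *v column j H = axis j 1"
    using assms by (simp add: vec_eq_iff matrix_matrix_mult_def matrix_vector_mult_def column_def mat_def axis_def)
  then have "column j H = (\<chi> k. det (\<chi> i l. if l = k then axis j 1 $ i else M $ i $ l) / det M)"
    using cramer[OF d] by blast
  then have "column j H $ k = cramer_inv M k j" by (simp add: cramer_inv_def)
  then show "H $ k $ j = cramer_inv M k j" by (simp add: column_def)
qed

lemma continuous_on_det:
  fixes M :: "'x::topological_space \<Rightarrow> real^'k^'k"
  assumes "\<And>i j. continuous_on S (\<lambda>x. M x $ i $ j)"
  shows "continuous_on S (\<lambda>x. det (M x))"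
  unfolding det_def by (intro continuous_intros assms)

lemma continuous_on_cramer_inv:
  fixes M :: "'x::topological_space \<Rightarrow> real^'k^'k"
  assumes "\<And>i j. continuous_on S (\<lambda>x. M x $ i $ j)" "\<And>x. x \<in> S \<Longrightarrow> det (M x) \<noteq> 0"
  shows "continuous_on S (\<lambda>x. cramer_inv (M x) k j)"
  unfolding cramer_inv_def
proof (intro continuous_on_divide continuous_on_det)
  show "continuous_on S (\<lambda>x. (\<chi> i l. if l = k then axis j 1 $ i else M x $ i $ l) $ i $ l)" for i l
    using assms(1) by (cases "l = k") auto
qed (use assms in auto)

text \<open>For \<open>T = from_coords A c p\<close> these are the components
  \<open>g\<^sub>i\<^sub>j\<close> of the metric in the chart \<open>c\<close>.\<close>

definition gram :: "('m, real^'k) tensor \<Rightarrow> (real^'k \<Rightarrow> real^'k) \<Rightarrow> 'm \<Rightarrow> real^'k^'k" where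
  "gram g T p = (\<chi> i j. g p [T (axis i 1), T (axis j 1)])"

context
  fixes A :: "('m, real^'k) chart set" and g :: "('m, real^'k) tensor"
    and T S :: "real^'k \<Rightarrow> real^'k"
  assumes g: "riemannian_metric A g" and T: "linear T" and S: "linear S"
    and TS: "\<And>v. T (S v) = v" and ST: "\<And>v. S (T v) = v"
begin

text \<open>\<open>S e\<close> holds the components of \<open>e\<close> in the frame. Expanding a
  frame vector in the orthonormal basis shows that the sums of products of these components invert
  the Gram matrix, whichever orthonormal basis is taken.\<close>

lemma gram_inverse:
  assumes b: "orthonormal_basis g p b"
  shows "gram g T p ** (\<chi> i j. \<Sum>e\<in>b. S e $ i * S e $ j) = mat 1"
proof -
  have exp: "(\<Sum>k\<in>UNIV. g p [u, T (axis k 1)] * S e $ k) = g p [u, e]" for u e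
    using linear_vec_expand[OF linear_compose[OF T metric_linear(2)[OF g]], of p u "S e"] TS
    by (simp add: o_def mult.commute)
  have "(\<Sum>k\<in>UNIV. gram g T p $ i $ k * (\<Sum>e\<in>b. S e $ k * S e $ j)) = mat 1 $ i $ j" for i j
  proof -
    have "(\<Sum>k\<in>UNIV. gram g T p $ i $ k * (\<Sum>e\<in>b. S e $ k * S e $ j)) =
      (\<Sum>e\<in>b. (\<Sum>k\<in>UNIV. gram g T p $ i $ k * S e $ k) * S e $ j)"
      unfolding sum_distrib_left sum_distrib_right by (subst sum.swap) (simp add: mult.assoc)
    also have "\<dots> = (\<Sum>e\<in>b. g p [T (axis i 1), e] * S e $ j)" by (simp add: gram_def exp)
    also have "\<dots> = S (\<Sum>e\<in>b. g p [T (axis i 1), e] *\<^sub>R e) $ j"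
      by (simp add: linear_sum[OF S] linear_scale[OF S])
    also have "\<dots> = S (T (axis i 1)) $ j"
      using orthonormal_basis_expand[OF g b, of "T (axis i 1)"] by simp
    finally show ?thesis by (auto simp: ST mat_def axis_def)
  qed
  then show ?thesis by (simp add: vec_eq_iff matrix_matrix_mult_def)
qed

lemma det_gram_nonzero: "det (gram g T p) \<noteq> 0"
  using ex_orthonormal_basis[OF g, of p] cramer_inv_eq(1)[OF gram_inverse] by blast

text \<open>The classical formula 1/2 g^{ik} g^{jl} \<alpha>_{ij} \<beta>_{kl}: every basis vector
  is expanded in the frame, and the products of components are collected into the inverse Gram
  matrix. The chosen basis has disappeared from the right side.\<close>

lemma form_inner_2_coords:
  assumes \<alpha>: "\<And>v. linear (\<lambda>u. \<alpha> p [u, v])" "\<And>u. linear (\<lambda>v. \<alpha> p [u, v])"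
    and \<beta>: "\<And>v. linear (\<lambda>u. \<beta> p [u, v])" "\<And>u. linear (\<lambda>v. \<beta> p [u, v])"
  shows "form_inner g 2 \<alpha> \<beta> p = (\<Sum>i\<in>UNIV. \<Sum>j\<in>UNIV. \<Sum>k\<in>UNIV. \<Sum>l\<in>UNIV.
     \<alpha> p [T (axis i 1), T (axis j 1)] * \<beta> p [T (axis k 1), T (axis l 1)] *
     (cramer_inv (gram g T p) i k * cramer_inv (gram g T p) j l)) / 2"
proof -
  obtain b where b: "orthonormal_basis g p b"
    and fi: "\<And>\<alpha> \<beta>. form_inner g 2 \<alpha> \<beta> p = (\<Sum>e\<in>b. \<Sum>e'\<in>b. \<alpha> p [e, e'] * \<beta> p [e, e']) / 2"
    using form_inner_2_eq[OF g, of p] by blast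
  have H: "cramer_inv (gram g T p) i k = (\<Sum>e\<in>b. S e $ i * S e $ k)" for i k
    using cramer_inv_eq(2)[OF gram_inverse[OF b], of i k] by simp
  have exp: "\<gamma> p [e, e'] = (\<Sum>i\<in>UNIV. \<Sum>j\<in>UNIV. S e $ i * S e' $ j * \<gamma> p [T (axis i 1), T (axis j 1)])"
    if "\<And>v. linear (\<lambda>u. \<gamma> p [u, v])" "\<And>u. linear (\<lambda>v. \<gamma> p [u, v])" for \<gamma> e e'
  proof -
    have "\<gamma> p [e, e'] = (\<Sum>i\<in>UNIV. S e $ i * \<gamma> p [T (axis i 1), e'])"
      using linear_vec_expand[OF linear_compose[OF T that(1)], of e' "S e"] TS by (simp add: o_def)
    also have "\<dots> = (\<Sum>i\<in>UNIV. S e $ i * (\<Sum>j\<in>UNIV. S e' $ j * \<gamma> p [T (axis i 1), T (axis j 1)]))"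
      using linear_vec_expand[OF linear_compose[OF T that(2)], of _ "S e'"] TS by (simp add: o_def)
    finally show ?thesis by (simp add: sum_distrib_left mult.assoc)
  qed
  define a where "a i j = \<alpha> p [T (axis i 1), T (axis j 1)]" for i j
  define c where "c i j = \<beta> p [T (axis i 1), T (axis j 1)]" for i j
  have ea: "\<alpha> p [e, e'] = (\<Sum>i\<in>UNIV. \<Sum>j\<in>UNIV. S e $ i * S e' $ j * a i j)"
    and ec: "\<beta> p [e, e'] = (\<Sum>i\<in>UNIV. \<Sum>j\<in>UNIV. S e $ i * S e' $ j * c i j)" for e e'
    unfolding a_def c_def by (rule exp[where \<gamma>=\<alpha>, OF \<alpha>], rule exp[where \<gamma>=\<beta>, OF \<beta>])
  have "(\<Sum>e\<in>b. \<Sum>e'\<in>b. \<alpha> p [e, e'] * \<beta> p [e, e']) =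
    (\<Sum>e\<in>b. \<Sum>e'\<in>b. \<Sum>i\<in>UNIV. \<Sum>j\<in>UNIV. \<Sum>k\<in>UNIV. \<Sum>l\<in>UNIV. a i j * c k l * ((S e $ i * S e $ k) * (S e' $ j * S e' $ l)))"
    unfolding ea ec sum_distrib_right
    unfolding sum_distrib_left by (intro sum.cong refl) (simp add: mult_ac)
  \<comment> \<open>Restricted to these index sets, \<open>sum.swap\<close> moves both sums over
    \<open>b\<close> innermost and cannot loop.\<close>
  also have "\<dots> = (\<Sum>i\<in>UNIV. \<Sum>j\<in>UNIV. \<Sum>k\<in>UNIV. \<Sum>l\<in>UNIV. \<Sum>e\<in>b. \<Sum>e'\<in>b. a i j * c k l * ((S e $ i * S e $ k) * (S e' $ j * S e' $ l)))"
    by (simp only: sum.swap[where A=b and B="UNIV :: 'k set"])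
  also have "\<dots> = (\<Sum>i\<in>UNIV. \<Sum>j\<in>UNIV. \<Sum>k\<in>UNIV. \<Sum>l\<in>UNIV. a i j * c k l * (cramer_inv (gram g T p) i k * cramer_inv (gram g T p) j l))"
    unfolding H sum_product unfolding sum_distrib_left by simp
  finally show ?thesis unfolding fi a_def c_def by simp
qed

end

section \<open>Integration\<close>

text \<open>\<open>form_integral\<close> selects its partition by choice, so one has to exist. Each
  point is the centre of a coordinate ball carrying a tent function; compactness leaves finitely
  many of these with positive sum everywhere, by which they are divided.\<close>

lemma ex_partition_of_unity:
  fixes A :: "('m::{t2_space,second_countable_topology}, 'e::euclidean_space) chart set"
  assumes "compact (UNIV :: 'm set)" and A: "smooth_atlas A"
  shows "\<exists>C \<rho>. partition_of_unity A C \<rho>"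
proof -
  note at = chart_at[OF A] and ch = smooth_atlasD(1)[OF A chart_at(1)[OF A]]
  let ?c = "chart_at A"
  have "\<exists>r>0. cball (chart_map (?c p) p) r \<subseteq> chart_image (?c p)" for p
    using open_chart_image[OF ch, of p] at(2)[of p] open_contains_cball by blast
  then obtain r where r: "\<And>p. r p > 0" "\<And>p. cball (chart_map (?c p) p) (r p) \<subseteq> chart_image (?c p)"
    by metis
  \<comment> \<open>Positive exactly on the open coordinate ball of radius \<open>r p\<close>. The
    closed ball \<open>K p\<close> is compact, hence closed in the Hausdorff space, which keeps the
    closure of the support inside the chart.\<close>
  define bump where "bump p q = (if q \<in> chart_dom (?c p)
    then max 0 (r p - dist (chart_map (?c p) q) (chart_map (?c p) p)) else 0)" for p q
  define K where "K p = chart_inv (?c p) ` cball (chart_map (?c p) p) (r p)" for p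
  have K: "closed (K p)" "K p \<subseteq> chart_dom (?c p)" for p
  proof -
    have "compact (K p)" unfolding K_def
      by (intro compact_continuous_image continuous_on_subset[OF continuous_on_chart_inv[OF ch] r(2)] compact_cball)
    then show "closed (K p)" by (rule compact_imp_closed)
    show "K p \<subseteq> chart_dom (?c p)" unfolding K_def
      by (intro image_subsetI chart_inv_in_dom) (use r(2)[of p] in blast)
  qed
  have supp: "q \<in> K p" if "bump p q \<noteq> 0" for p q
  proof -
    have q: "q \<in> chart_dom (?c p)" "dist (chart_map (?c p) p) (chart_map (?c p) q) \<le> r p"
      using that by (auto simp: bump_def dist_commute split: if_splits)
    then show ?thesis unfolding K_def
      by (intro image_eqI[of _ _ "chart_map (?c p) q"]) (auto simp: chart_inv_map[OF ch])
  qed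
  have cont: "continuous_on UNIV (bump p)" for p
  proof -
    have "continuous_on (chart_dom (?c p)) (bump p)"
      by (rule continuous_on_eq[of _ "\<lambda>q. max 0 (r p - dist (chart_map (?c p) q) (chart_map (?c p) p))"])
        (auto simp: bump_def intro!: continuous_intros continuous_on_chart_map[OF ch])
    moreover have "continuous_on (- K p) (bump p)"
      by (rule continuous_on_eq[of _ "\<lambda>q. 0"]) (use supp in auto)
    ultimately have "continuous_on (chart_dom (?c p) \<union> - K p) (bump p)"
      by (rule continuous_on_open_Un[rotated 2]) (use open_chart_dom[OF ch] K(1) in auto)
    moreover have "chart_dom (?c p) \<union> - K p = UNIV" using K(2) by blast
    ultimately show ?thesis by simp
  qed
  have pos: "bump p q \<ge> 0" "bump p p > 0" for p q using r(1)[of p] at(2)[of p] by (auto simp: bump_def)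
  have "open {q. bump p q > 0}" for p
    using cont[of p] by (intro open_Collect_less) auto
  moreover have "UNIV \<subseteq> (\<Union>p. {q. bump p q > 0})" using pos(2) by blast
  ultimately obtain P where P: "finite P" "UNIV \<subseteq> (\<Union>p\<in>P. {q. bump p q > 0})"
    by (rule compactE_image[OF assms(1)])
  define tot where "tot q = (\<Sum>p\<in>P. bump p q)" for q
  have tot: "tot q > 0" for q
  proof -
    obtain p where "p \<in> P" "bump p q > 0" using P(2) by blast
    then show ?thesis unfolding tot_def by (intro sum_pos2[OF P(1)]) (auto simp: pos)
  qed
  \<comment> \<open>Partition functions are indexed by charts, and several points of
    \<open>P\<close> may share their chosen chart, so the bumps are added up over such
    points.\<close>
  define \<rho> where "\<rho> c q = (\<Sum>p\<in>{p \<in> P. ?c p = c}. bump p q) / tot q" for c q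
  have ct: "continuous_on UNIV tot" unfolding tot_def by (intro continuous_on_sum cont)
  have "partition_of_unity A (?c ` P) \<rho>"
    unfolding partition_of_unity_def
  proof (intro conjI ballI allI)
    fix c assume "c \<in> ?c ` P"
    show "continuous_on UNIV (\<rho> c)" unfolding \<rho>_def
      by (intro continuous_on_divide continuous_on_sum cont ct) (simp add: tot[THEN less_imp_neq, symmetric])
    show "\<rho> c q \<ge> 0" for q unfolding \<rho>_def by (intro divide_nonneg_pos sum_nonneg pos tot)
    show "closure {q. \<rho> c q \<noteq> 0} \<subseteq> chart_dom c"
    proof -
      have "{q. \<rho> c q \<noteq> 0} \<subseteq> (\<Union>p\<in>{p \<in> P. ?c p = c}. K p)"
      proof
        fix q assume "q \<in> {q. \<rho> c q \<noteq> 0}"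
        then have "(\<Sum>p\<in>{p \<in> P. ?c p = c}. bump p q) \<noteq> 0" by (auto simp: \<rho>_def)
        then obtain p where "p \<in> {p \<in> P. ?c p = c}" "bump p q \<noteq> 0" by (rule sum.not_neutral_contains_not_neutral)
        then show "q \<in> (\<Union>p\<in>{p \<in> P. ?c p = c}. K p)" using supp by blast
      qed
      moreover have "closed (\<Union>p\<in>{p \<in> P. ?c p = c}. K p)" using P(1) K(1) by (intro closed_UN) auto
      ultimately have "closure {q. \<rho> c q \<noteq> 0} \<subseteq> (\<Union>p\<in>{p \<in> P. ?c p = c}. K p)" by (rule closure_minimal)
      then show ?thesis using K(2) by blast
    qed
  next
    fix q
    have "(\<Sum>c\<in>?c ` P. \<Sum>p\<in>{p \<in> P. ?c p = c}. bump p q) = tot q"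
      unfolding tot_def by (rule sum.image_gen[OF P(1), symmetric])
    then show "(\<Sum>c\<in>?c ` P. \<rho> c q) = 1"
      unfolding \<rho>_def sum_divide_distrib[symmetric] using tot[of q] by simp
  qed (use P(1) at(1) in auto)
  then show ?thesis by blast
qed

text \<open>Reduction to the Leibniz rule on a box containing \<open>K\<close>, after extension by
  zero. The extension is continuous because \<open>U\<close> and the complement of \<open>K\<close>
  form an open cover and it is evidently continuous on each.\<close>

lemma has_real_derivative_integral_compact_support:
  fixes f f' :: "real \<Rightarrow> 'e::euclidean_space \<Rightarrow> real"
  assumes U: "open U" and K: "compact K" "K \<subseteq> U" and \<epsilon>: "\<epsilon> > 0"
    and der: "\<And>t x. t \<in> {-\<epsilon><..<\<epsilon>} \<Longrightarrow> x \<in> U \<Longrightarrow> ((\<lambda>t. f t x) has_real_derivative f' t x) (at t)"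
    and contf: "\<And>t. t \<in> {-\<epsilon><..<\<epsilon>} \<Longrightarrow> continuous_on U (f t)"
    and cont: "continuous_on ({-\<epsilon><..<\<epsilon>} \<times> U) (\<lambda>z. f' (fst z) (snd z))"
    and supp: "\<And>t x. t \<in> {-\<epsilon><..<\<epsilon>} \<Longrightarrow> x \<in> U - K \<Longrightarrow> f t x = 0" "\<And>t x. t \<in> {-\<epsilon><..<\<epsilon>} \<Longrightarrow> x \<in> U - K \<Longrightarrow> f' t x = 0"
  shows "((\<lambda>t. integral U (f t)) has_real_derivative integral U (f' 0)) (at 0)"
proof -
  let ?I = "{-\<epsilon><..<\<epsilon>}"
  obtain a b where ab: "K \<subseteq> cbox a b" using bounded_subset_cbox_symmetric compact_imp_bounded K(1) by metis
  define E where "E h x = (if x \<in> U then h x else 0)" for h :: "'e \<Rightarrow> real" and x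
  have int: "integral (cbox a b) (E h) = integral U h" if "\<And>x. x \<in> U - K \<Longrightarrow> h x = 0" for h
  proof -
    have "(\<lambda>x. if x \<in> cbox a b then E h x else 0) = (\<lambda>x. if x \<in> U then h x else 0)"
      using that ab by (auto simp: E_def fun_eq_iff)
    then show ?thesis using integral_restrict_UNIV[of "cbox a b" "E h"] integral_restrict_UNIV[of U h] by simp
  qed
  have cE: "continuous_on UNIV (E (f t))" if t: "t \<in> ?I" for t
  proof -
    have "continuous_on U (E (f t))" by (rule continuous_on_eq[OF contf[OF t]]) (simp add: E_def)
    moreover have "continuous_on (- K) (E (f t))"
      by (rule continuous_on_eq[of _ "\<lambda>q. 0"]) (use supp(1)[OF t] in \<open>auto simp: E_def\<close>)
    ultimately have "continuous_on (U \<union> - K) (E (f t))"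
      by (rule continuous_on_open_Un[rotated 2]) (use U compact_imp_closed[OF K(1)] in auto)
    moreover have "U \<union> - K = UNIV" using K(2) by blast
    ultimately show ?thesis by simp
  qed
  have cE': "continuous_on (?I \<times> cbox a b) (\<lambda>(t, x). E (f' t) x)"
  proof -
    have "continuous_on (?I \<times> U) (\<lambda>(t, x). E (f' t) x)"
      by (rule continuous_on_eq[OF cont]) (auto simp: E_def)
    moreover have "continuous_on (?I \<times> - K) (\<lambda>(t, x). E (f' t) x)"
      by (rule continuous_on_eq[of _ "\<lambda>q. 0"]) (use supp(2) in \<open>auto simp: E_def\<close>)
    ultimately have "continuous_on (?I \<times> U \<union> ?I \<times> - K) (\<lambda>(t, x). E (f' t) x)"
      by (rule continuous_on_open_Un[rotated 2]) (use U compact_imp_closed[OF K(1)] in \<open>auto intro!: open_Times\<close>)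
    then show ?thesis by (rule continuous_on_subset) (use K(2) in auto)
  qed
  have "((\<lambda>t. integral (cbox a b) (E (f t))) has_real_derivative integral (cbox a b) (E (f' 0))) (at 0 within ?I)"
  proof (rule leibniz_rule_field_derivative[OF _ _ cE'])
    show "((\<lambda>t. E (f t) x) has_real_derivative E (f' t) x) (at t within ?I)" if "t \<in> ?I" for t x
      using der[OF that, of x] by (cases "x \<in> U") (auto simp: E_def intro: has_field_derivative_at_within)
    show "E (f t) integrable_on cbox a b" if "t \<in> ?I" for t
      by (rule integrable_continuous[OF continuous_on_subset[OF cE[OF that]]]) simp
  qed (use \<epsilon> in auto)
  then have "((\<lambda>t. integral (cbox a b) (E (f t))) has_real_derivative integral (cbox a b) (E (f' 0))) (at 0)"
    using \<epsilon> at_within_open[of 0 ?I] by simp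
  then have "((\<lambda>t. integral (cbox a b) (E (f t))) has_real_derivative integral U (f' 0)) (at 0)"
    using int[of "f' 0"] supp(2)[of 0] \<epsilon> by simp
  then show ?thesis
    by (rule DERIV_cong_ev[OF refl _ refl, THEN iffD1, rotated])
      (use eventually_nhds_in_open[of ?I 0] \<epsilon> int supp(1) in \<open>auto elim!: eventually_mono\<close>)
qed

text \<open>The Gram matrix in the chart \<open>c\<close> is V G V^T, so its determinant has root
  |det V| sqrt(det G); orientation makes det V positive and removes the absolute value.\<close>

lemma volume_form_coords:
  fixes A :: "('m::{t2_space,second_countable_topology}, real^'k) chart set"
  assumes or: "oriented_atlas A" and g: "riemannian_metric A g" and c: "c \<in> A" "p \<in> chart_dom c"
  shows "volume_form g p (\<chi> i. from_coords A c p (axis i 1)) =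
    sqrt (det (gram g (from_coords A c p) p))"
proof -
  define T where "T = from_coords A c p"
  have A: "smooth_atlas A" using or unfolding oriented_atlas_def by blast
  define V :: "real^'k^'k" where "V = (\<chi> i. T (axis i 1))"
  define G :: "real^'k^'k" where "G = (\<chi> i j. g p [axis i 1, axis j 1])"
  have "det (matrix T) > 0"
    using or c chart_at[OF A, of p] unfolding oriented_atlas_def T_def from_coords_def by blast
  \<comment> \<open>Frames are stored as rows, whereas \<open>matrix T\<close> has the images of the
    axes as columns.\<close>
  moreover have "V = transpose (matrix T)" by (simp add: V_def matrix_def transpose_def vec_eq_iff)
  ultimately have V: "det V > 0" by simp
  have e1: "g p [u, w] = (\<Sum>k\<in>UNIV. u $ k * g p [axis k 1, w])" for u w
    using linear_vec_expand[OF metric_linear(1)[OF g, of p w], of u] by simp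
  have e2: "g p [axis k 1, w] = (\<Sum>l\<in>UNIV. G $ k $ l * w $ l)" for k w
    using linear_vec_expand[OF metric_linear(2)[OF g, of p "axis k 1"], of w] by (simp add: G_def mult.commute)
  have "(\<chi> i j. g p [T (axis i 1), T (axis j 1)]) = V ** (G ** transpose V)"
    by (simp add: vec_eq_iff matrix_matrix_mult_def e1[of "T _"] e2 V_def transpose_def)
  then have "det (\<chi> i j. g p [T (axis i 1), T (axis j 1)]) = det V * det V * det G"
    by (simp add: det_mul mult_ac)
  then show ?thesis
    using V unfolding gram_def T_def[symmetric] V_def[symmetric] by (simp add: volume_form_def real_sqrt_mult G_def)
qed

section \<open>The first variation of the energy\<close>

locale metric_variation = variation A B \<Phi> \<epsilon> \<omega>
  for A :: "('m::{t2_space,second_countable_topology}, real^'k) chart set"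
    and B :: "('n::{t2_space,second_countable_topology}, 'f::euclidean_space) chart set"
    and \<Phi> \<epsilon> \<omega> +
  fixes g :: "('m, real^'k) tensor"
  assumes compact_M: "compact (UNIV :: 'm set)" and or: "oriented_atlas A" and g: "riemannian_metric A g"
    and closed: "ext_deriv B \<omega> q [u, v, w] = 0"
begin

definition gram_at :: "('m, real^'k) chart \<Rightarrow> real^'k \<Rightarrow> real^'k^'k" where
  "gram_at c x = gram g (from_coords A c (chart_inv c x)) (chart_inv c x)"

definition vol :: "('m, real^'k) chart \<Rightarrow> real^'k \<Rightarrow> real" where
  "vol c x = sqrt (det (gram_at c x))"

definition ginv :: "('m, real^'k) chart \<Rightarrow> real^'k \<Rightarrow> 'k \<Rightarrow> 'k \<Rightarrow> real" where
  "ginv c x i k = cramer_inv (gram_at c x) i k"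

definition pb :: "('m, real^'k) chart \<Rightarrow> real \<Rightarrow> real^'k \<Rightarrow> 'k \<Rightarrow> 'k \<Rightarrow> real" where
  "pb c t x i j = tensor_coords A c (pullback A B (\<Phi> t) \<omega>) x [axis i 1, axis j 1]"

text \<open>Taken as a partial derivative of the joint function of time and point, so that joint
  continuity comes with the smoothness of the pullback.\<close>

definition pb' :: "('m, real^'k) chart \<Rightarrow> real \<Rightarrow> real^'k \<Rightarrow> 'k \<Rightarrow> 'k \<Rightarrow> real" where
  "pb' c t x i j = frechet_derivative (\<lambda>z. pb c (fst z) (snd z) i j) (at (t, x)) (1, 0)"

abbreviation "normsq t \<equiv> form_inner g 2 (pullback A B (\<Phi> t) \<omega>) (pullback A B (\<Phi> t) \<omega>)"

lemmas coords_facts =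
  linear_from_coords[OF A smooth_chartI[OF A]] linear_to_coords[OF A smooth_chartI[OF A]]
  from_to_coords[OF A smooth_chartI[OF A]] to_from_coords[OF A smooth_chartI[OF A]]

lemma continuous_on_gram_at:
  assumes "c \<in> A"
  shows "continuous_on (chart_image c) (\<lambda>x. gram_at c x $ i $ j)"
proof -
  have "smooth_on (chart_image c) (\<lambda>x. tensor_coords A c g x [axis i 1, axis j 1])"
    using g assms unfolding riemannian_metric_def smooth_tensor_def by simp
  then show ?thesis
    unfolding gram_at_def gram_def tensor_coords_def using smooth_on_imp_continuous_on by auto
qed

lemma det_gram_at:
  assumes c: "c \<in> A" and x: "x \<in> chart_image c"
  shows "det (gram_at c x) \<noteq> 0"
proof -
  note p = chart_inv_in_dom[OF x]
  show ?thesis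
    unfolding gram_at_def
    by (rule det_gram_nonzero[OF g coords_facts(1)[OF c p] coords_facts(2)[OF c p] coords_facts(3)[OF c p]
          coords_facts(4)[OF c p]])
qed

lemma continuous_on_vol: "c \<in> A \<Longrightarrow> continuous_on (chart_image c) (vol c)"
  unfolding vol_def by (intro continuous_on_real_sqrt continuous_on_det continuous_on_gram_at)

lemma continuous_on_ginv: "c \<in> A \<Longrightarrow> continuous_on (chart_image c) (\<lambda>x. ginv c x i k)"
  unfolding ginv_def by (intro continuous_on_cramer_inv continuous_on_gram_at det_gram_at)

text \<open>The pair precedes \<open>f\<close> in the quantifiers because the choice inside
  \<open>form_integral\<close> does not mention the integrand.\<close>

lemma integral_vol_eq:
  "\<exists>C \<rho>. partition_of_unity A C \<rho> \<and> (\<forall>f. integral_vol A g f =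
      (\<Sum>c\<in>C. integral (chart_image c) (\<lambda>x. \<rho> c (chart_inv c x) * (f (chart_inv c x) * vol c x))))"
proof -
  obtain C \<rho> where z: "(SOME (C, \<rho>). partition_of_unity A C \<rho>) = (C, \<rho>)"
    by (metis surj_pair)
  have pu: "partition_of_unity A C \<rho>"
    using someI_ex[of "\<lambda>(C, \<rho>). partition_of_unity A C \<rho>"] ex_partition_of_unity[OF compact_M A] z by auto
  have C: "C \<subseteq> A" using pu unfolding partition_of_unity_def by blast
  have "integral_vol A g f =
      (\<Sum>c\<in>C. integral (chart_image c) (\<lambda>x. \<rho> c (chart_inv c x) * (f (chart_inv c x) * vol c x)))" for f
    unfolding integral_vol_def form_integral_def z Let_def prod.case
  proof (intro sum.cong integral_cong refl)
    fix c x assume c: "c \<in> C" and x: "x \<in> chart_image c"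
    have "volume_form g (chart_inv c x) (\<chi> i. from_coords A c (chart_inv c x) (axis i 1)) = vol c x"
      unfolding vol_def gram_at_def by (rule volume_form_coords[OF or g]) (use c C chart_inv_in_dom[OF x] in auto)
    then show "\<rho> c (chart_inv c x) * (f (chart_inv c x) * volume_form g (chart_inv c x) (\<chi> i. from_coords A c (chart_inv c x) (axis i 1)))
       = \<rho> c (chart_inv c x) * (f (chart_inv c x) * vol c x)" by simp
  qed
  with pu show ?thesis by blast
qed

lemma form_inner_2_chart:
  assumes c: "c \<in> A" and x: "x \<in> chart_image c"
    and \<alpha>: "\<And>v. linear (\<lambda>u. \<alpha> (chart_inv c x) [u, v])" "\<And>u. linear (\<lambda>v. \<alpha> (chart_inv c x) [u, v])"
    and \<beta>: "\<And>v. linear (\<lambda>u. \<beta> (chart_inv c x) [u, v])" "\<And>u. linear (\<lambda>v. \<beta> (chart_inv c x) [u, v])"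
  shows "form_inner g 2 \<alpha> \<beta> (chart_inv c x) = (\<Sum>i\<in>UNIV. \<Sum>j\<in>UNIV. \<Sum>k\<in>UNIV. \<Sum>l\<in>UNIV.
     tensor_coords A c \<alpha> x [axis i 1, axis j 1] * tensor_coords A c \<beta> x [axis k 1, axis l 1] *
     (ginv c x i k * ginv c x j l)) / 2"
proof -
  note p = chart_inv_in_dom[OF x]
  show ?thesis
    using form_inner_2_coords[OF g coords_facts(1)[OF c p] coords_facts(2)[OF c p] coords_facts(3)[OF c p]
      coords_facts(4)[OF c p], of \<alpha> "chart_inv c x" \<beta>] \<alpha> \<beta>
    unfolding ginv_def gram_at_def tensor_coords_def by simp
qed

lemma pullback_linear:
  assumes "t \<in> I"
  shows "linear (\<lambda>u. pullback A B (\<Phi> t) \<omega> p [u, v])" "linear (\<lambda>v. pullback A B (\<Phi> t) \<omega> p [u, v])"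
  by (rule smooth_tensor2_linear[OF conjunct1[OF smooth_form_pullback[OF assms, unfolded smooth_form_def]]])+

text \<open>The exterior derivative is the time derivative at 0 of a family of bilinear forms, so by
  uniqueness of derivatives it inherits bilinearity.\<close>

lemma ext_deriv_iota_linear:
  "linear (\<lambda>u. ext_deriv A iota p [u, v])" "linear (\<lambda>v. ext_deriv A iota p [u, v])"
proof -
  have 0: "0 \<in> I" using \<epsilon> by simp
  note der = pullback_has_derivative[OF closed]
  note eqI = DERIV_unique[OF der has_field_derivative_transform_within_open[OF _ open_greaterThanLessThan 0]]
  note lin = pullback_linear[THEN linear_add] pullback_linear[THEN linear_scale]
  show "linear (\<lambda>u. ext_deriv A iota p [u, v])"
    by (rule linearI; (unfold real_scaleR_def)?; rule eqI)
       (rule DERIV_add[OF der der] DERIV_cmult[OF der], simp add: lin)+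
  show "linear (\<lambda>v. ext_deriv A iota p [u, v])"
    by (rule linearI; (unfold real_scaleR_def)?; rule eqI)
       (rule DERIV_add[OF der der] DERIV_cmult[OF der], simp add: lin)+
qed

lemma pb_has_derivative:
  assumes c: "c \<in> A" and t: "t \<in> I" and x: "x \<in> chart_image c"
  shows "((\<lambda>t. pb c t x i j) has_real_derivative pb' c t x i j) (at t)"
proof -
  have "((\<lambda>z. pb c (fst z) (snd z) i j) has_derivative
      frechet_derivative (\<lambda>z. pb c (fst z) (snd z) i j) (at (t, x))) (at (t, x))"
    unfolding pb_def by (rule smooth_on_has_derivative[OF smooth_on_pullback[OF c]]) (use t x in auto)
  from has_derivative_slice(3)[OF this] show ?thesis
    by (simp add: has_real_derivative_iff_has_vector_derivative pb'_def)
qed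

text \<open>Uniqueness of the time derivative identifies the partial derivative, which serves
  continuity, with the geometric one from Cartan's formula.\<close>

lemma pb'_0:
  assumes c: "c \<in> A" and x: "x \<in> chart_image c"
  shows "pb' c 0 x i j = tensor_coords A c (ext_deriv A iota) x [axis i 1, axis j 1]"
proof -
  have "((\<lambda>t. pb c t x i j) has_real_derivative tensor_coords A c (ext_deriv A iota) x [axis i 1, axis j 1]) (at 0)"
    unfolding pb_def tensor_coords_def list.map by (rule pullback_has_derivative[OF closed])
  from DERIV_unique[OF pb_has_derivative[OF c _ x] this] \<epsilon> show ?thesis by simp
qed

lemma continuous_on_pb:
  assumes c: "c \<in> A"
  shows "continuous_on (I \<times> chart_image c) (\<lambda>z. pb c (fst z) (snd z) i j)"
    and "continuous_on (I \<times> chart_image c) (\<lambda>z. pb' c (fst z) (snd z) i j)"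
proof -
  have s: "smooth_on (I \<times> chart_image c) (\<lambda>z. pb c (fst z) (snd z) i j)"
    unfolding pb_def by (rule smooth_on_pullback[OF c])
  show "continuous_on (I \<times> chart_image c) (\<lambda>z. pb c (fst z) (snd z) i j)"
    by (rule smooth_on_imp_continuous_on[OF s])
  show "continuous_on (I \<times> chart_image c) (\<lambda>z. pb' c (fst z) (snd z) i j)"
    using smooth_on_imp_continuous_on[OF smooth_on_frechet_derivative_const[OF s, of "(1, 0)"]]
    by (simp add: pb'_def)
qed

text \<open>The integrand is quadratic in the pullback: the product rule yields two terms, equal by
  symmetry of the inner product, whence the factor 2.\<close>

lemma chart_integral_has_derivative:
  assumes pu: "partition_of_unity A C \<rho>" and cC: "c \<in> C"
  shows "((\<lambda>t. integral (chart_image c) (\<lambda>x. \<rho> c (chart_inv c x) * (normsq t (chart_inv c x) * vol c x)))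
    has_real_derivative 2 * integral (chart_image c) (\<lambda>x. \<rho> c (chart_inv c x) *
       (form_inner g 2 (ext_deriv A iota) (pullback A B (\<Phi> 0) \<omega>) (chart_inv c x) * vol c x))) (at 0)"
proof -
  let ?U = "chart_image c"
  define S where "S = closure {p. \<rho> c p \<noteq> 0}"
  have c: "c \<in> A" and cont_\<rho>: "continuous_on UNIV (\<rho> c)" and S: "S \<subseteq> chart_dom c"
    using pu cC unfolding partition_of_unity_def S_def by auto
  note ch = smooth_atlasD(1)[OF A c]
  \<comment> \<open>Support of the partition function in coordinates; outside this compact set the
    integrand vanishes at all times.\<close>
  define K where "K = chart_map c ` S"
  have "compact S" using compact_Int_closed[OF compact_M, of S] by (simp add: S_def)
  then have K: "compact K" "K \<subseteq> ?U"
    unfolding K_def using S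
    by (auto intro!: compact_continuous_image continuous_on_subset[OF continuous_on_chart_map[OF ch]])
  have \<rho>0: "\<rho> c (chart_inv c x) = 0" if "x \<in> ?U - K" for x
  proof (rule ccontr)
    assume "\<rho> c (chart_inv c x) \<noteq> 0"
    then have "chart_inv c x \<in> S" unfolding S_def by (intro subsetD[OF closure_subset]) simp
    then have "chart_map c (chart_inv c x) \<in> K" unfolding K_def by (rule imageI)
    then show False using that chart_map_inv[of x c] by simp
  qed
  define Q where "Q t x = (\<Sum>i\<in>UNIV. \<Sum>j\<in>UNIV. \<Sum>k\<in>UNIV. \<Sum>l\<in>UNIV.
     pb c t x i j * pb c t x k l * (ginv c x i k * ginv c x j l)) / 2" for t x
  \<comment> \<open>Derivative of \<open>Q\<close> in the exact shape that \<open>DERIV_mult\<close>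
    produces; at time 0, \<open>Q'0\<close> recognizes two inner products in it.\<close>
  define Q' where "Q' t x = (\<Sum>i\<in>UNIV. \<Sum>j\<in>UNIV. \<Sum>k\<in>UNIV. \<Sum>l\<in>UNIV.
     (pb' c t x i j * pb c t x k l + pb' c t x k l * pb c t x i j) * (ginv c x i k * ginv c x j l)) / 2" for t x
  have Q: "normsq t (chart_inv c x) = Q t x" if "t \<in> I" "x \<in> ?U" for t x
    unfolding Q_def pb_def by (rule form_inner_2_chart[OF c that(2) pullback_linear pullback_linear]) (use that in auto)
  have Q'0: "Q' 0 x = 2 * form_inner g 2 (ext_deriv A iota) (pullback A B (\<Phi> 0) \<omega>) (chart_inv c x)"
    if x: "x \<in> ?U" for x
  proof -
    have 0: "0 \<in> I" using \<epsilon> by simp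
    have "Q' 0 x = form_inner g 2 (ext_deriv A iota) (pullback A B (\<Phi> 0) \<omega>) (chart_inv c x)
        + form_inner g 2 (pullback A B (\<Phi> 0) \<omega>) (ext_deriv A iota) (chart_inv c x)"
      unfolding form_inner_2_chart[OF c x ext_deriv_iota_linear pullback_linear[OF 0]]
        form_inner_2_chart[OF c x pullback_linear[OF 0] ext_deriv_iota_linear]
      unfolding Q'_def pb'_0[OF c x] pb_def
      by (simp only: distrib_right sum.distrib add_divide_distrib) (simp add: mult_ac)
    moreover have "form_inner g 2 (pullback A B (\<Phi> 0) \<omega>) (ext_deriv A iota) (chart_inv c x)
       = form_inner g 2 (ext_deriv A iota) (pullback A B (\<Phi> 0) \<omega>) (chart_inv c x)"
      by (simp add: form_inner_def mult.commute)
    ultimately show ?thesis by simp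
  qed
  have sub: "snd ` (I \<times> ?U) \<subseteq> ?U" by auto
  note cH = continuous_on_compose2[OF continuous_on_ginv[OF c] continuous_on_snd[OF continuous_on_id] sub]
  have c\<rho>: "continuous_on ?U (\<lambda>x. \<rho> c (chart_inv c x))"
    by (rule continuous_on_compose2[OF cont_\<rho> continuous_on_chart_inv[OF ch]]) auto
  have "((\<lambda>t. integral ?U (\<lambda>x. \<rho> c (chart_inv c x) * (Q t x * vol c x))) has_real_derivative
      integral ?U (\<lambda>x. \<rho> c (chart_inv c x) * (Q' 0 x * vol c x))) (at 0)"
  proof (rule has_real_derivative_integral_compact_support[OF open_chart_image[OF ch] K \<epsilon>])
    show "((\<lambda>t. \<rho> c (chart_inv c x) * (Q t x * vol c x)) has_real_derivative
        \<rho> c (chart_inv c x) * (Q' t x * vol c x)) (at t)" if "t \<in> I" "x \<in> ?U" for t x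
      unfolding Q_def Q'_def
      by (intro DERIV_cmult DERIV_cmult_right DERIV_cdivide DERIV_sum DERIV_mult pb_has_derivative[OF c that])
    have cQ: "continuous_on (I \<times> ?U) (\<lambda>z. Q (fst z) (snd z))"
      unfolding Q_def by (intro continuous_intros continuous_on_pb[OF c] cH) auto
    show "continuous_on ?U (\<lambda>x. \<rho> c (chart_inv c x) * (Q t x * vol c x))" if "t \<in> I" for t
    proof -
      have "continuous_on ?U (\<lambda>x. Q t x)"
        by (rule continuous_on_compose2[OF cQ, of ?U "Pair t", simplified]) (use that in \<open>auto intro!: continuous_intros\<close>)
      then show ?thesis by (intro continuous_intros c\<rho> continuous_on_vol[OF c])
    qed
    show "continuous_on (I \<times> ?U) (\<lambda>z. \<rho> c (chart_inv c (snd z)) * (Q' (fst z) (snd z) * vol c (snd z)))"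
      unfolding Q'_def
      by (intro continuous_intros continuous_on_pb[OF c] cH
          continuous_on_compose2[OF c\<rho> continuous_on_snd[OF continuous_on_id] sub]
          continuous_on_compose2[OF continuous_on_vol[OF c] continuous_on_snd[OF continuous_on_id] sub]) auto
  qed (simp_all add: \<rho>0)
  moreover have "integral ?U (\<lambda>x. \<rho> c (chart_inv c x) * (Q' 0 x * vol c x)) =
     2 * integral ?U (\<lambda>x. \<rho> c (chart_inv c x) *
       (form_inner g 2 (ext_deriv A iota) (pullback A B (\<Phi> 0) \<omega>) (chart_inv c x) * vol c x))"
    unfolding integral_mult_right[symmetric] by (intro integral_cong) (simp add: Q'0)
  moreover have "integral ?U (\<lambda>x. \<rho> c (chart_inv c x) * (Q t x * vol c x)) =
     integral ?U (\<lambda>x. \<rho> c (chart_inv c x) * (normsq t (chart_inv c x) * vol c x))" if "t \<in> I" for t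
    by (intro integral_cong) (simp add: Q[OF that])
  \<comment> \<open>The integrals with \<open>Q\<close> and with \<open>normsq\<close> were compared
    for \<open>t\<close> in \<open>I\<close>, an open neighbourhood of 0, which determines the
    derivative there.\<close>
  ultimately show ?thesis
    by (auto intro: has_field_derivative_transform_within_open[of _ _ _ I] simp: \<epsilon>)
qed

lemma energy_has_derivative:
  "((\<lambda>t. energy A g B \<omega> (\<Phi> t)) has_real_derivative
     integral_vol A g (form_inner g 2 (ext_deriv A iota) (pullback A B (\<Phi> 0) \<omega>))) (at 0)"
proof -
  obtain C \<rho> where pu: "partition_of_unity A C \<rho>" and iv: "\<And>f. integral_vol A g f =
      (\<Sum>c\<in>C. integral (chart_image c) (\<lambda>x. \<rho> c (chart_inv c x) * (f (chart_inv c x) * vol c x)))"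
    using integral_vol_eq by blast
  have "((\<lambda>t. energy A g B \<omega> (\<Phi> t)) has_real_derivative
     1/2 * (\<Sum>c\<in>C. 2 * integral (chart_image c) (\<lambda>x. \<rho> c (chart_inv c x) *
       (form_inner g 2 (ext_deriv A iota) (pullback A B (\<Phi> 0) \<omega>) (chart_inv c x) * vol c x)))) (at 0)"
    unfolding energy_def iv by (intro DERIV_cmult DERIV_sum chart_integral_has_derivative[OF pu])
  then show ?thesis unfolding iv sum_distrib_left by simp
qed

end

theorem proposition2p2:
  fixes A :: "('m::{t2_space,second_countable_topology}, real^'k) chart set"
    and g :: "('m, real^'k) tensor"
    and B :: "('n::{t2_space,second_countable_topology}, 'f::euclidean_space) chart set"
    and h :: "('n, 'f) tensor"
    and J :: "'n \<Rightarrow> 'f \<Rightarrow> 'f"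
    and \<omega> :: "('n, 'f) tensor"
    and \<phi> :: "'m \<Rightarrow> 'n"
    and \<Phi> :: "real \<Rightarrow> 'm \<Rightarrow> 'n"
    and X :: "'m \<Rightarrow> 'f"
    and \<delta> :: "('m, real^'k) tensor \<Rightarrow> ('m, real^'k) tensor"
  assumes "compact (UNIV :: 'm set)" and "oriented_atlas A" and "riemannian_metric A g"
    and "compact (UNIV :: 'n set)" and "kaehler_manifold B h J"
    and "\<omega> = kaehler_form h J"
    and "smooth_map_on A B UNIV \<phi>"
    and "smooth_variation A B \<phi> \<Phi>"
    and "\<And>p. X p = velocity B (\<lambda>t. \<Phi> t p) 0"
    and "codifferential A g 1 \<delta>"
  shows "((\<lambda>t. energy A g B \<omega> (\<Phi> t)) has_real_derivative
           integral_vol A g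
             (\<lambda>p. \<omega> (\<phi> p)
                [X p, tangent_map A B \<phi> p (sharp g (\<delta> (pullback A B \<phi> \<omega>)) p)]))
         (at 0)"
proof -
  have K: "smooth_atlas B" "riemannian_metric B h" "complex_structure B J"
    "\<And>q u v. h q [J q u, J q v] = h q [u, v]" "\<And>q u v w. ext_deriv B \<omega> q [u, v, w] = 0"
    using assms(5) unfolding kaehler_manifold_def assms(6) by blast+
  have \<phi>: "\<Phi> 0 = \<phi>" using assms(8) unfolding smooth_variation_def by blast
  obtain \<epsilon> where \<epsilon>: "\<epsilon> > 0"
    "smooth_map_on (line_times A) B ({-\<epsilon><..<\<epsilon>} \<times> UNIV) (\<lambda>(t, p). \<Phi> t p)"
    using assms(8) unfolding smooth_variation_def by blast
  have \<omega>: "smooth_form B 2 \<omega>"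
    unfolding assms(6) by (rule smooth_form_kaehler_form[OF K(1,3,2,4)])
  interpret metric_variation A B \<Phi> \<epsilon> \<omega> g
    by unfold_locales (use assms(1-3) K \<epsilon> \<omega> in \<open>auto simp: oriented_atlas_def\<close>)
  let ?\<beta> = "pullback A B \<phi> \<omega>"
  have \<beta>: "smooth_form A 2 ?\<beta>" using smooth_form_pullback[of 0] \<epsilon>(1) by (simp add: \<phi>)
  \<comment> \<open>For \<open>k = 1\<close> the definition of \<open>codifferential\<close> speaks
    of degree \<open>Suc 1\<close>, written 2 elsewhere.\<close>
  have two: "Suc 1 = 2" by simp
  have cod: "smooth_form A 1 (\<delta> ?\<beta>)"
    "integral_vol A g (form_inner g 2 (ext_deriv A iota) ?\<beta>) = integral_vol A g (form_inner g 1 iota (\<delta> ?\<beta>))"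
    using assms(10) \<beta> smooth_form_iota unfolding codifferential_def two by blast+
  have lin: "linear (\<lambda>v. \<eta> p [v])" if "smooth_form A 1 \<eta>" for \<eta> p
  proof -
    have "length vs = 1 \<and> i < 1 \<longrightarrow> linear (\<lambda>u. \<eta> p (vs[i := u]))" for vs i
      using that unfolding smooth_form_def smooth_tensor_def by blast
    from this[of "[0]" 0] show ?thesis by simp
  qed
  \<comment> \<open>An equality of functions on \<open>M\<close>, so the two integrals are equal by
    substitution.\<close>
  have "form_inner g 1 iota (\<delta> ?\<beta>) = (\<lambda>p. \<omega> (\<phi> p) [X p, tangent_map A B \<phi> p (sharp g (\<delta> ?\<beta>) p)])"
  proof
    fix p
    have "form_inner g 1 iota (\<delta> ?\<beta>) p = iota p [sharp g (\<delta> ?\<beta>) p]"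
      by (rule form_inner_1_sharp[OF g lin[OF smooth_form_iota] lin[OF cod(1)]])
    then show "form_inner g 1 iota (\<delta> ?\<beta>) p = \<omega> (\<phi> p) [X p, tangent_map A B \<phi> p (sharp g (\<delta> ?\<beta>) p)]"
      by (simp add: iota_def \<phi> assms(9))
  qed
  then show ?thesis using energy_has_derivative cod(2) by (simp add: \<phi>)
qed

end
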